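(* Let $n \ge 0$, and for each noncrossing partition $\lambda$ of size $n$ fix an element $w_\lambda \in \mathcal{C}_\lambda$. Then the set $\{\phi(w_\lambda) : \lambda \text{ a noncrossing partition of size } n\}$ is a basis of the Temperley--Lieb algebra $\mathsf{TL}_n(2)$ over $\mathbb{C}$.
   Context: Write $[n] = \{1,\dots,n\}$ and let $S_n$ be the group of permutations of $[n]$, with $w_i=w(i)$ and simple transpositions $s_i = (i\ i{+}1)$. The Temperley--Lieb algebra $\mathsf{TL}_n(2)$ is the unital associative $\mathbb{C}$-algebra generated by $e_1,\dots,e_{n-1}$ subject to $e_i^2 = 2e_i$; $e_ie_j = e_je_i$ if $|i-j|>1$; and $e_ie_je_i = e_i$ if $|i-j|=1$. The map $\phi:\mathbb{C}S_n\to\mathsf{TL}_n(2)$ is the surjective algebra homomorphism determined by $\phi(s_i) = 1-e_i$. A noncrossing partition of size $n$ is a set $\lambda$ of arcs $(i,j)$ with $1 \le i < j \le n$ such that there are no two distinct arcs $(i,k), (j,l) \in \lambda$ with $i \le j < k \le l$. $\lambda^{+}$ (resp. $\lambda^{-}$) denotes the set of all left (resp. right) endpoints of arcs of $\lambda$, where $(i,j)$ has left endpoint $i$ and right endpoint $j$. For $w \in S_n$, set $E_{pos}(w) = \{ i \in [n] : i \le w_i\}$ and $E_{val}(w) = \{ w_i : i\in[n],\ i \le w_i\}$. The excedance class of $\lambda$ is $\mathcal{C}_\lambda = \{ w \in S_n : E_{val}(w) = [n] \setminus \lambda^{+} \text{ and } E_{pos}(w) = [n]\setminus \lambda^{-}\}$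 (these sets are nonempty). *)

theory Defs
  imports
    "HOL-Algebra.Sym_Groups"
    "HOL-Algebra.QuotRing"
    "HOL-Algebra.Module"
    "HOL-Algebra.Embedded_Algebras"
    "HOL-Library.Poly_Mapping"
begin

section \<open>Complex algebras\<close>

text \<open>A complex algebra is a record of type \<open>(complex, 'a) module\<close>: a ring with a scalar
  multiplication.  (The locale \<open>algebra\<close> of HOL-Algebra is restricted to commutative algebras.)\<close>

definition monoid_algebra :: "('a, 'm) monoid_scheme \<Rightarrow> (complex, 'a \<Rightarrow>\<^sub>0 complex) module" where
  "monoid_algebra G =
    \<lparr>carrier = {f. Poly_Mapping.keys f \<subseteq> carrier G},
     mult = (\<lambda>f g. \<Sum>a\<in>Poly_Mapping.keys f. \<Sum>b\<in>Poly_Mapping.keys g.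
       Poly_Mapping.single (a \<otimes>\<^bsub>G\<^esub> b) (Poly_Mapping.lookup f a * Poly_Mapping.lookup g b)),
     one = Poly_Mapping.single \<one>\<^bsub>G\<^esub> 1,
     zero = 0,
     add = (+),
     smult = (\<lambda>c f. Poly_Mapping.map ((*) c) f)\<rparr>"

text \<open>The quotient ring \<open>A Quot I\<close> with the scalar multiplication
  \<open>c (I + x) = I + c x\<close>.\<close>

definition quot_algebra :: "(complex, 'a) module \<Rightarrow> 'a set \<Rightarrow> (complex, 'a set) module" where
  "quot_algebra A I =
    \<lparr>carrier = carrier (A Quot I),
     mult = mult (A Quot I),
     one = one (A Quot I),
     zero = zero (A Quot I),
     add = add (A Quot I),
     smult = (\<lambda>c X. \<Union>x\<in>X. I +>\<^bsub>A\<^esub> (c \<odot>\<^bsub>A\<^esub> x))\<rparr>"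

definition alg_hom :: "(complex, 'a) module \<Rightarrow> (complex, 'b) module \<Rightarrow> ('a \<Rightarrow> 'b) set" where
  "alg_hom A B =
    {h \<in> ring_hom A B. \<forall>c. \<forall>x\<in>carrier A. h (c \<odot>\<^bsub>A\<^esub> x) = c \<odot>\<^bsub>B\<^esub> h x}"

text \<open>In HOL-Algebra, linear span and linear independence in a possibly noncommutative algebra are
  taken over a subfield of the algebra.  For a nonzero complex algebra this subfield is the copy
  \<open>\<complex> 1\<close> of the complex numbers.\<close>

definition scalars :: "(complex, 'a) module \<Rightarrow> 'a set" where
  "scalars A = {c \<odot>\<^bsub>A\<^esub> \<one>\<^bsub>A\<^esub> | c. True}"

definition is_finite_basis :: "(complex, 'a) module \<Rightarrow> 'a set \<Rightarrow> bool" where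
  "is_finite_basis A B \<longleftrightarrow>
    (\<exists>Us. set Us = B \<and> ring.independent A (scalars A) Us \<and>
          ring.Span A (scalars A) Us = carrier A)"


section \<open>The Temperley-Lieb algebra\<close>

definition word_monoid :: "'a set \<Rightarrow> 'a list monoid" where
  "word_monoid X = \<lparr>carrier = lists X, mult = (@), one = []\<rparr>"

abbreviation free_algebra :: "'a set \<Rightarrow> (complex, 'a list \<Rightarrow>\<^sub>0 complex) module" where
  "free_algebra X \<equiv> monoid_algebra (word_monoid X)"

text \<open>The letter \<open>i\<close> stands for the generator \<open>e\<^sub>i\<close>; a relation \<open>l = r\<close> is encoded as \<open>l - r\<close>.\<close>

definition TL_relators :: "nat \<Rightarrow> (nat list \<Rightarrow>\<^sub>0 complex) set" where
  "TL_relators n =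
     {Poly_Mapping.single [i, i] 1 - Poly_Mapping.single [i] 2 | i. i \<in> {1..<n}} \<union>
     {Poly_Mapping.single [i, j] 1 - Poly_Mapping.single [j, i] 1 | i j.
        i \<in> {1..<n} \<and> j \<in> {1..<n} \<and> \<bar>int i - int j\<bar> > 1} \<union>
     {Poly_Mapping.single [i, j, i] 1 - Poly_Mapping.single [i] 1 | i j.
        i \<in> {1..<n} \<and> j \<in> {1..<n} \<and> \<bar>int i - int j\<bar> = 1}"

definition TL_ideal :: "nat \<Rightarrow> (nat list \<Rightarrow>\<^sub>0 complex) set" where
  "TL_ideal n = Idl\<^bsub>free_algebra {1..<n}\<^esub> (TL_relators n)"

definition TL :: "nat \<Rightarrow> (complex, (nat list \<Rightarrow>\<^sub>0 complex) set) module" where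
  "TL n = quot_algebra (free_algebra {1..<n}) (TL_ideal n)"

definition TL_gen :: "nat \<Rightarrow> nat \<Rightarrow> (nat list \<Rightarrow>\<^sub>0 complex) set" where
  "TL_gen n i = TL_ideal n +>\<^bsub>free_algebra {1..<n}\<^esub> Poly_Mapping.single [i] 1"


section \<open>The group algebra of the symmetric group\<close>

abbreviation sym_algebra :: "nat \<Rightarrow> (complex, (nat \<Rightarrow> nat) \<Rightarrow>\<^sub>0 complex) module" where
  "sym_algebra n \<equiv> monoid_algebra (sym_group n)"

abbreviation perm_elt :: "(nat \<Rightarrow> nat) \<Rightarrow> ((nat \<Rightarrow> nat) \<Rightarrow>\<^sub>0 complex)" where
  "perm_elt w \<equiv> Poly_Mapping.single w 1"


section \<open>Noncrossing partitions and excedance classes\<close>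

text \<open>Nested arcs are allowed, but no two distinct arcs share a left endpoint or share a right
  endpoint.\<close>

definition noncrossing_partition :: "nat \<Rightarrow> (nat \<times> nat) set \<Rightarrow> bool" where
  "noncrossing_partition n P \<longleftrightarrow>
     (\<forall>(i, j) \<in> P. 1 \<le> i \<and> i < j \<and> j \<le> n) \<and>
     \<not> (\<exists>i j k l. (i, k) \<in> P \<and> (j, l) \<in> P \<and> (i, k) \<noteq> (j, l) \<and>
           i \<le> j \<and> j < k \<and> k \<le> l)"

definition exc_pos :: "nat \<Rightarrow> (nat \<Rightarrow> nat) \<Rightarrow> nat set" where
  "exc_pos n w = {i \<in> {1..n}. i \<le> w i}"

definition exc_val :: "nat \<Rightarrow> (nat \<Rightarrow> nat) \<Rightarrow> nat set" where
  "exc_val n w = {w i | i. i \<in> {1..n} \<and> i \<le> w i}"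

definition exc_class :: "nat \<Rightarrow> (nat \<times> nat) set \<Rightarrow> (nat \<Rightarrow> nat) set" where
  "exc_class n P = {w \<in> carrier (sym_group n).
     exc_val n w = {1..n} - fst ` P \<and> exc_pos n w = {1..n} - snd ` P}"

end

theory Submission
  imports Defs
begin

text \<open>Spanning: since \<open>\<phi>\<close> kills the antisymmetrizer of any three positions, every \<open>\<phi>(w)\<close>
  is a combination of images of 321-avoiding permutations. A 321-avoiding permutation is increasing
  on its excedance positions and on the remaining positions, hence is determined by its excedance
  class, so the dimension of \<open>TL\<^sub>n(2)\<close> is at most the number of noncrossing partitions.

  Independence: \<open>TL\<^sub>n(2)\<close> acts on functions of subsets of \<open>[n]\<close>, with \<open>w\<close> acting by permuting
  points (this is the action on \<open>(\<complex>\<^sup>2)\<^sup>\<otimes>\<^sup>n\<close>). The matrix coefficient of \<open>w\<close> attached to \<open>\<lambda>\<close> is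
  1 if \<open>w(\<lambda>\<^sup>-) = \<lambda>\<^sup>+\<close> and 0 otherwise. Give \<open>\<lambda>\<close> the weight \<open>\<Sum> (2(j - i) - 1)\<close> over its arcs
  \<open>(i, j)\<close>. If \<open>w \<in> C\<^sub>\<mu>\<close> then \<open>\<Sum> (2(j - w\<^sub>j) - 1)\<close> over \<open>j \<in> S\<close> is largest exactly for
  \<open>S = {j. w\<^sub>j < j} = \<mu>\<^sup>-\<close>, so the coefficients form a unitriangular matrix.\<close>

section \<open>Monoid algebras and quotients as complex algebras\<close>

locale complex_algebra = ring A for A :: "(complex, 'a) module" (structure) +
  assumes smult_closed [simp, intro]: "x \<in> carrier A \<Longrightarrow> c \<odot> x \<in> carrier A"
    and smult_l_distr: "x \<in> carrier A \<Longrightarrow> (c + d) \<odot> x = c \<odot> x \<oplus> d \<odot> x"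
    and smult_r_distr: "\<lbrakk>x \<in> carrier A; y \<in> carrier A\<rbrakk> \<Longrightarrow> c \<odot> (x \<oplus> y) = c \<odot> x \<oplus> c \<odot> y"
    and smult_assoc: "x \<in> carrier A \<Longrightarrow> (c * d) \<odot> x = c \<odot> (d \<odot> x)"
    and smult_one [simp]: "x \<in> carrier A \<Longrightarrow> 1 \<odot> x = x"
    and smult_mult_left: "\<lbrakk>x \<in> carrier A; y \<in> carrier A\<rbrakk> \<Longrightarrow> (c \<odot> x) \<otimes> y = c \<odot> (x \<otimes> y)"
    and smult_mult_right: "\<lbrakk>x \<in> carrier A; y \<in> carrier A\<rbrakk> \<Longrightarrow> x \<otimes> (c \<odot> y) = c \<odot> (x \<otimes> y)"
begin

lemma smult_zero [simp]: "x \<in> carrier A \<Longrightarrow> 0 \<odot> x = \<zero>"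
  using smult_l_distr[of x 0 0] smult_closed[of x 0] by (simp add: add.l_cancel_one)

lemma smult_minus_one: "x \<in> carrier A \<Longrightarrow> (-1) \<odot> x = \<ominus> x"
  using smult_l_distr[of x "-1" 1] by (intro minus_equality[symmetric]) simp_all

lemma smult_mult_one: "x \<in> carrier A \<Longrightarrow> (c \<odot> \<one>) \<otimes> x = c \<odot> x"
  by (simp add: smult_mult_left)

lemma ideal_smult_closed:
  assumes "ideal I A" "x \<in> I"
  shows "c \<odot> x \<in> I"
proof -
  interpret ideal I A by fact
  have "(c \<odot> \<one>) \<otimes> x \<in> I" using assms(2) by (simp add: I_l_closed)
  then show ?thesis using assms(2) by (simp add: smult_mult_one a_Hcarr)
qed

lemma subfield_scalars:
  assumes "\<one> \<noteq> \<zero>"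
  shows "subfield (scalars A) A"
proof -
  have mult: "(c \<odot> \<one>) \<otimes> (d \<odot> \<one>) = (c * d) \<odot> \<one>" for c d
    by (simp add: smult_mult_one smult_assoc)
  have scI: "c \<odot> \<one> \<in> scalars A" for c
    unfolding scalars_def by blast
  have scE: thesis if "h \<in> scalars A" "\<And>c. h = c \<odot> \<one> \<Longrightarrow> thesis" for h thesis
    using that unfolding scalars_def by blast
  have "subring (scalars A) A"
  proof (rule subringI)
    show "scalars A \<subseteq> carrier A" by (auto elim: scE)
    show "\<one> \<in> scalars A" using scI[of 1] by simp
    show "\<ominus> h \<in> scalars A" if "h \<in> scalars A" for h
      using that
    proof (rule scE)
      fix c assume "h = c \<odot> \<one>"
      then have "\<ominus> h = (- 1 * c) \<odot> \<one>"
        by (simp only: smult_assoc[OF one_closed] smult_minus_one smult_closed one_closed)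
      then show ?thesis by (simp only: scI)
    qed
    show "h1 \<otimes> h2 \<in> scalars A" if "h1 \<in> scalars A" "h2 \<in> scalars A" for h1 h2
      using that by (elim scE) (simp only: mult scI)
    show "h1 \<oplus> h2 \<in> scalars A" if "h1 \<in> scalars A" "h2 \<in> scalars A" for h1 h2
      using that by (elim scE) (simp only: smult_l_distr[OF one_closed, symmetric] scI)
  qed
  then have "subcring (scalars A) A"
    by (rule subcringI) (elim scE, simp only: mult mult.commute)
  moreover have "Units (A\<lparr>carrier := scalars A\<rparr>) = scalars A - {\<zero>}"
  proof
    show "Units (A\<lparr>carrier := scalars A\<rparr>) \<subseteq> scalars A - {\<zero>}"
    proof
      fix h assume "h \<in> Units (A\<lparr>carrier := scalars A\<rparr>)"
      then obtain k where h: "h \<in> scalars A" and k: "k \<in> scalars A" "k \<otimes> h = \<one>"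
        by (auto simp: Units_def)
      from k(1) have "k \<in> carrier A" by (rule scE) simp
      with h k(2) assms show "h \<in> scalars A - {\<zero>}" by auto
    qed
    show "scalars A - {\<zero>} \<subseteq> Units (A\<lparr>carrier := scalars A\<rparr>)"
    proof
      fix h assume h: "h \<in> scalars A - {\<zero>}"
      then obtain c where c: "h = c \<odot> \<one>" by (blast elim: scE)
      with h have "c \<noteq> 0" by auto
      then have "(inverse c \<odot> \<one>) \<otimes> h = \<one>" "h \<otimes> (inverse c \<odot> \<one>) = \<one>"
        by (simp_all add: c mult)
      then show "h \<in> Units (A\<lparr>carrier := scalars A\<rparr>)"
        using h scI[of "inverse c"] by (auto simp: Units_def)
    qed
  qed
  ultimately show ?thesis by (rule subfieldI)
qed

end

lemma finite_support_induct [consumes 1, case_names zero add single]: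
  assumes "Poly_Mapping.keys f \<subseteq> X"
    and "P 0"
    and "\<And>f g. \<lbrakk>Poly_Mapping.keys f \<subseteq> X; Poly_Mapping.keys g \<subseteq> X; P f; P g\<rbrakk> \<Longrightarrow> P (f + g)"
    and "\<And>k c. k \<in> X \<Longrightarrow> P (Poly_Mapping.single k c)"
  shows "P f"
  using assms(1)
proof (induction f rule: update_induct)
  case const
  show ?case by (rule assms(2))
next
  case (update f a b)
  have eq: "Poly_Mapping.update a b f = f + Poly_Mapping.single a b"
    using update(1)
    by (intro poly_mapping_eqI) (auto simp: lookup_update lookup_add lookup_single in_keys_iff when_def)
  have "a \<in> X" "Poly_Mapping.keys f \<subseteq> X"
    using update by (auto simp: keys_update)
  then show ?case unfolding eq
    using update(3) by (intro assms(3,4)) (auto split: if_splits)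
qed

context
  fixes G :: "('a, 'm) monoid_scheme" (structure)
begin

lemma monoid_algebra_simps:
  "carrier (monoid_algebra G) = {f. Poly_Mapping.keys f \<subseteq> carrier G}"
  "\<one>\<^bsub>monoid_algebra G\<^esub> = Poly_Mapping.single \<one> 1"
  "\<zero>\<^bsub>monoid_algebra G\<^esub> = 0"
  "f \<oplus>\<^bsub>monoid_algebra G\<^esub> g = f + g"
  "c \<odot>\<^bsub>monoid_algebra G\<^esub> f = Poly_Mapping.map ((*) c) f"
  by (simp_all add: monoid_algebra_def)

lemma lookup_smult: "Poly_Mapping.lookup (c \<odot>\<^bsub>monoid_algebra G\<^esub> f) k = c * Poly_Mapping.lookup f k"
  by (simp add: monoid_algebra_simps Poly_Mapping.map.rep_eq when_def)

lemma keys_smult: "Poly_Mapping.keys (c \<odot>\<^bsub>monoid_algebra G\<^esub> f) \<subseteq> Poly_Mapping.keys f"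
  by (auto simp: in_keys_iff lookup_smult)

lemma smult_single:
  "c \<odot>\<^bsub>monoid_algebra G\<^esub> Poly_Mapping.single k d = Poly_Mapping.single k (c * d)"
  by (intro poly_mapping_eqI) (simp add: lookup_smult lookup_single when_def)

lemma smult_add:
  "c \<odot>\<^bsub>monoid_algebra G\<^esub> (f + g) = c \<odot>\<^bsub>monoid_algebra G\<^esub> f + c \<odot>\<^bsub>monoid_algebra G\<^esub> g"
  by (intro poly_mapping_eqI) (simp add: lookup_smult lookup_add distrib_left)

lemma mult_superset:
  assumes "finite S" "Poly_Mapping.keys f \<subseteq> S" "finite T" "Poly_Mapping.keys g \<subseteq> T"
  shows "f \<otimes>\<^bsub>monoid_algebra G\<^esub> g = (\<Sum>a\<in>S. \<Sum>b\<in>T.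
    Poly_Mapping.single (a \<otimes> b) (Poly_Mapping.lookup f a * Poly_Mapping.lookup g b))"
proof -
  have "f \<otimes>\<^bsub>monoid_algebra G\<^esub> g = (\<Sum>a\<in>S. \<Sum>b\<in>Poly_Mapping.keys g.
    Poly_Mapping.single (a \<otimes> b) (Poly_Mapping.lookup f a * Poly_Mapping.lookup g b))"
    using assms by (auto simp: monoid_algebra_def in_keys_iff intro!: sum.mono_neutral_left)
  also have "\<dots> = (\<Sum>a\<in>S. \<Sum>b\<in>T.
    Poly_Mapping.single (a \<otimes> b) (Poly_Mapping.lookup f a * Poly_Mapping.lookup g b))"
    using assms by (intro sum.cong sum.mono_neutral_left) (auto simp: in_keys_iff)
  finally show ?thesis .
qed

lemma mult_single_single:
  "Poly_Mapping.single a c \<otimes>\<^bsub>monoid_algebra G\<^esub> Poly_Mapping.single b d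
    = Poly_Mapping.single (a \<otimes> b) (c * d)"
  by (simp add: mult_superset[of "{a}" _ "{b}"])

lemma mult_zero [simp]:
  "0 \<otimes>\<^bsub>monoid_algebra G\<^esub> g = 0" "f \<otimes>\<^bsub>monoid_algebra G\<^esub> 0 = 0"
  by (simp_all add: monoid_algebra_def)

lemma mult_add_left:
  "(f + f') \<otimes>\<^bsub>monoid_algebra G\<^esub> g = f \<otimes>\<^bsub>monoid_algebra G\<^esub> g + f' \<otimes>\<^bsub>monoid_algebra G\<^esub> g"
proof -
  let ?S = "Poly_Mapping.keys f \<union> Poly_Mapping.keys f'"
  have "Poly_Mapping.keys (f + f') \<subseteq> ?S" by (rule Poly_Mapping.keys_add)
  then show ?thesis
    by (simp add: mult_superset[of ?S _ "Poly_Mapping.keys g"] lookup_add single_add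
        distrib_right sum.distrib)
qed

lemma mult_add_right:
  "f \<otimes>\<^bsub>monoid_algebra G\<^esub> (g + g') = f \<otimes>\<^bsub>monoid_algebra G\<^esub> g + f \<otimes>\<^bsub>monoid_algebra G\<^esub> g'"
proof -
  let ?T = "Poly_Mapping.keys g \<union> Poly_Mapping.keys g'"
  have "Poly_Mapping.keys (g + g') \<subseteq> ?T" by (rule Poly_Mapping.keys_add)
  then show ?thesis
    by (simp add: mult_superset[of "Poly_Mapping.keys f" _ ?T] lookup_add single_add
        distrib_left sum.distrib)
qed

end

lemma mult_in_monoid_algebra:
  fixes G (structure)
  assumes "monoid G" and f: "Poly_Mapping.keys f \<subseteq> carrier G" and g: "Poly_Mapping.keys g \<subseteq> carrier G"
  shows "Poly_Mapping.keys (f \<otimes>\<^bsub>monoid_algebra G\<^esub> g) \<subseteq> carrier G"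
  using f
proof (induction rule: finite_support_induct)
  case (add f f')
  then show ?case unfolding mult_add_left by (intro order_trans[OF Poly_Mapping.keys_add] Un_least)
next
  case f: (single a c)
  from g show ?case
  proof (induction rule: finite_support_induct)
    case (add g g')
    then show ?case unfolding mult_add_right by (intro order_trans[OF Poly_Mapping.keys_add] Un_least)
  next
    case (single b d)
    with f assms(1) show ?case by (auto simp: mult_single_single monoid.m_closed)
  qed simp
qed simp

lemma mult_assoc_monoid_algebra:
  fixes G (structure)
  assumes "monoid G" and f: "Poly_Mapping.keys f \<subseteq> carrier G"
    and g: "Poly_Mapping.keys g \<subseteq> carrier G" and h: "Poly_Mapping.keys h \<subseteq> carrier G"
  shows "f \<otimes>\<^bsub>monoid_algebra G\<^esub> g \<otimes>\<^bsub>monoid_algebra G\<^esub> h =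
    f \<otimes>\<^bsub>monoid_algebra G\<^esub> (g \<otimes>\<^bsub>monoid_algebra G\<^esub> h)"
  using f
proof (induction rule: finite_support_induct)
  case f: (single a c)
  from g show ?case
  proof (induction rule: finite_support_induct)
    case g: (single b d)
    from h show ?case
    proof (induction rule: finite_support_induct)
      case (single k e)
      with f g assms(1) show ?case by (simp add: mult_single_single monoid.m_assoc mult.assoc)
    qed (simp_all add: mult_add_right)
  qed (simp_all add: mult_add_right mult_add_left)
qed (simp_all add: mult_add_left)

lemma smult_mult_monoid_algebra:
  fixes G (structure)
  shows "(c \<odot>\<^bsub>monoid_algebra G\<^esub> f) \<otimes>\<^bsub>monoid_algebra G\<^esub> g
      = c \<odot>\<^bsub>monoid_algebra G\<^esub> (f \<otimes>\<^bsub>monoid_algebra G\<^esub> g)" (is ?l)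
    and "f \<otimes>\<^bsub>monoid_algebra G\<^esub> (c \<odot>\<^bsub>monoid_algebra G\<^esub> g)
      = c \<odot>\<^bsub>monoid_algebra G\<^esub> (f \<otimes>\<^bsub>monoid_algebra G\<^esub> g)" (is ?r)
proof -
  have zero: "c \<odot>\<^bsub>monoid_algebra G\<^esub> 0 = 0"
    by (intro poly_mapping_eqI) (simp add: lookup_smult)
  have "Poly_Mapping.keys f \<subseteq> UNIV" "Poly_Mapping.keys g \<subseteq> UNIV" by auto
  then have "?l \<and> ?r"
  proof (induction f rule: finite_support_induct)
    case (single a d)
    from single(2) show ?case
    proof (induction g rule: finite_support_induct)
      case (single b e)
      then show ?case by (simp add: mult_single_single smult_single mult.assoc mult.left_commute)
    qed (simp_all add: mult_add_right smult_add zero)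
  qed (simp_all add: mult_add_left smult_add zero)
  then show ?l ?r by auto
qed

lemma monoid_algebra_complex_algebra:
  fixes G (structure)
  assumes "monoid G"
  shows "complex_algebra (monoid_algebra G)"
proof -
  interpret G: monoid G by fact
  let ?A = "monoid_algebra G"
  have "abelian_group ?A"
  proof (rule abelian_groupI)
    show "x \<oplus>\<^bsub>?A\<^esub> y \<in> carrier ?A" if "x \<in> carrier ?A" "y \<in> carrier ?A" for x y
      using that Poly_Mapping.keys_add[of x y] by (auto simp: monoid_algebra_simps)
    show "\<exists>y\<in>carrier ?A. y \<oplus>\<^bsub>?A\<^esub> x = \<zero>\<^bsub>?A\<^esub>" if "x \<in> carrier ?A" for x
      using that by (intro bexI[of _ "- x"]) (auto simp: monoid_algebra_simps in_keys_iff)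
  qed (auto simp: monoid_algebra_simps algebra_simps)
  moreover have one: "\<one>\<^bsub>?A\<^esub> \<otimes>\<^bsub>?A\<^esub> f = f" "f \<otimes>\<^bsub>?A\<^esub> \<one>\<^bsub>?A\<^esub> = f" if "f \<in> carrier ?A" for f
  proof -
    have "Poly_Mapping.keys f \<subseteq> carrier G" using that by (simp add: monoid_algebra_simps)
    then have "\<one>\<^bsub>?A\<^esub> \<otimes>\<^bsub>?A\<^esub> f = f \<and> f \<otimes>\<^bsub>?A\<^esub> \<one>\<^bsub>?A\<^esub> = f"
      by (induction rule: finite_support_induct)
        (simp_all add: monoid_algebra_simps mult_add_left mult_add_right mult_single_single)
    then show "\<one>\<^bsub>?A\<^esub> \<otimes>\<^bsub>?A\<^esub> f = f" "f \<otimes>\<^bsub>?A\<^esub> \<one>\<^bsub>?A\<^esub> = f" by auto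
  qed
  moreover have "Group.monoid ?A"
    by (rule monoidI)
      (use one mult_in_monoid_algebra[OF assms] mult_assoc_monoid_algebra[OF assms] in
        \<open>auto simp: monoid_algebra_simps split: if_splits\<close>)
  ultimately have "ring ?A"
    by (intro ringI) (auto simp: monoid_algebra_simps(4) mult_add_left mult_add_right)
  then show ?thesis
  proof (intro complex_algebra.intro complex_algebra_axioms.intro)
    fix x c assume "x \<in> carrier ?A"
    then show "c \<odot>\<^bsub>?A\<^esub> x \<in> carrier ?A"
      using keys_smult[of G c x] by (auto simp: monoid_algebra_simps(1))
  qed (auto simp: smult_mult_monoid_algebra monoid_algebra_simps(4) smult_add
        intro!: poly_mapping_eqI simp: lookup_smult lookup_add algebra_simps)
qed

lemma quot_algebra_simps:
  "carrier (quot_algebra A J) = carrier (A Quot J)"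
  "X \<otimes>\<^bsub>quot_algebra A J\<^esub> Y = X \<otimes>\<^bsub>A Quot J\<^esub> Y"
  "X \<oplus>\<^bsub>quot_algebra A J\<^esub> Y = X \<oplus>\<^bsub>A Quot J\<^esub> Y"
  "\<one>\<^bsub>quot_algebra A J\<^esub> = \<one>\<^bsub>A Quot J\<^esub>"
  "\<zero>\<^bsub>quot_algebra A J\<^esub> = \<zero>\<^bsub>A Quot J\<^esub>"
  by (simp_all add: quot_algebra_def)

lemma quot_algebra_ring:
  assumes "ideal I A"
  shows "ring (quot_algebra A I)"
proof -
  interpret ring "A Quot I" using ideal.quotient_is_ring[OF assms] .
  show ?thesis
  proof (rule ringI)
    show "abelian_group (quot_algebra A I)"
    proof (rule abelian_groupI)
      show "\<exists>Y\<in>carrier (quot_algebra A I). Y \<oplus>\<^bsub>quot_algebra A I\<^esub> X = \<zero>\<^bsub>quot_algebra A I\<^esub>"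
        if "X \<in> carrier (quot_algebra A I)" for X
        using that l_neg[of X] by (auto simp: quot_algebra_simps)
    qed (simp_all add: quot_algebra_simps a_ac)
    show "Group.monoid (quot_algebra A I)"
      by (rule monoidI) (auto simp: quot_algebra_simps m_assoc)
  qed (auto simp: quot_algebra_simps l_distr r_distr)
qed

lemma quot_algebra_coset:
  fixes A (structure)
  assumes "complex_algebra A" "ideal I A" "x \<in> carrier A"
  shows "c \<odot>\<^bsub>quot_algebra A I\<^esub> (I +> x) = I +> (c \<odot> x)"
proof -
  interpret complex_algebra A by fact
  interpret I: ideal I A by fact
  have "I +> (c \<odot> y) = I +> (c \<odot> x)" if y: "y \<in> I +> x" for y
  proof -
    obtain h where h: "h \<in> I" "y = h \<oplus> x" using y by (auto simp: a_r_coset_def')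
    then have "c \<odot> y = c \<odot> h \<oplus> c \<odot> x" using assms(3) by (simp add: smult_r_distr I.a_Hcarr)
    then have "c \<odot> y \<in> I +> (c \<odot> x)"
      using ideal_smult_closed[OF assms(2) h(1)] by (auto simp: a_r_coset_def')
    then show ?thesis using assms(3) I.a_repr_independence' by (metis smult_closed)
  qed
  moreover have "x \<in> I +> x" using assms(3) by (rule I.a_rcos_self)
  ultimately have "(\<Union>y\<in>I +> x. I +> (c \<odot> y)) = I +> (c \<odot> x)"
    by (metis (mono_tags, lifting) SUP_eq_const empty_iff)
  then show ?thesis by (simp add: quot_algebra_def)
qed

lemma quot_algebra_carrierE:
  fixes A (structure)
  assumes "X \<in> carrier (quot_algebra A I)"
  obtains x where "x \<in> carrier A" "X = I +> x"
  using assms by (auto simp: quot_algebra_simps FactRing_simps)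

lemma coset_alg_hom:
  fixes A (structure)
  assumes "complex_algebra A" "ideal I A"
  shows "(+>) I \<in> alg_hom A (quot_algebra A I)"
  using ideal.rcos_ring_hom[OF assms(2)] quot_algebra_coset[OF assms]
  by (auto simp: alg_hom_def ring_hom_def quot_algebra_simps)

lemma quot_algebra_complex_algebra:
  fixes A (structure)
  assumes A: "complex_algebra A" and I: "ideal I A"
  shows "complex_algebra (quot_algebra A I)"
proof -
  interpret complex_algebra A by fact
  let ?Q = "quot_algebra A I"
  have hom: "(+>) I \<in> ring_hom A ?Q"
    and sm: "\<And>c x. x \<in> carrier A \<Longrightarrow> c \<odot>\<^bsub>?Q\<^esub> (I +> x) = I +> (c \<odot> x)"
    using coset_alg_hom[OF assms] by (auto simp: alg_hom_def)
  note [simp] = ring_hom_mult[OF hom, symmetric] ring_hom_add[OF hom, symmetric] sm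
  note closed = ring_hom_closed[OF hom]
  show ?thesis
    by (intro complex_algebra.intro complex_algebra_axioms.intro quot_algebra_ring[OF I];
        elim quot_algebra_carrierE)
      (auto intro!: closed simp: smult_l_distr smult_r_distr smult_assoc smult_mult_left
        smult_mult_right)
qed

section \<open>Excedance classes and 321-avoiding permutations\<close>

definition weight :: "nat \<Rightarrow> (nat \<Rightarrow> nat) \<Rightarrow> nat" where
  "weight n w = (\<Sum>i\<in>{1..n}. i * w i)"

lemma weight_le:
  assumes "w permutes {1..n}"
  shows "weight n w \<le> n * n * n"
proof -
  have "i * w i \<le> n * n" if "i \<in> {1..n}" for i
    using that permutes_in_image[OF assms, of i] by (intro mult_le_mono) auto
  then have "weight n w \<le> of_nat (card {1..n}) * (n * n)"
    unfolding weight_def by (rule sum_bounded_above)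
  then show ?thesis by simp
qed

lemma permutes_comp_transpose:
  "\<lbrakk>w permutes S; a \<in> S; b \<in> S\<rbrakk> \<Longrightarrow> w \<circ> transpose a b permutes S"
  by (intro permutes_compose permutes_swap_id)

lemma weight_less_transpose:
  assumes "a \<in> {1..n}" "b \<in> {1..n}" "a < b" "w b < w a"
  shows "weight n w < weight n (w \<circ> transpose a b)"
proof -
  have split: "weight n v = a * v a + (b * v b + (\<Sum>i\<in>{1..n} - {a} - {b}. i * v i))" for v
    unfolding weight_def
    using assms by (subst sum.remove[of _ a], simp, simp, subst sum.remove[of _ b]) auto
  have "(\<Sum>i\<in>{1..n} - {a} - {b}. i * (w \<circ> transpose a b) i) = (\<Sum>i\<in>{1..n} - {a} - {b}. i * w i)"
    by (intro sum.cong) (auto simp: transpose_def)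
  moreover have "a * w a + b * w b < a * w b + b * w a"
  proof -
    obtain d e where "b = a + d" "0 < d" "w a = w b + e" "0 < e"
      using assms(3,4) by (metis less_imp_add_positive)
    then show ?thesis by (simp add: algebra_simps)
  qed
  ultimately show ?thesis
    by (simp add: split[of w] split[of "w \<circ> transpose a b"])
qed

lemma strict_mono_on_eqI:
  fixes f g :: "nat \<Rightarrow> 'b::linorder"
  assumes f: "strict_mono_on S f" and g: "strict_mono_on S g" and im: "f ` S = g ` S"
    and "i \<in> S"
  shows "f i = g i"
  using \<open>i \<in> S\<close>
proof (induction i rule: less_induct)
  case (less i)
  have key: "\<not> h i < h' i"
    if mono: "strict_mono_on S h" "strict_mono_on S h'" and sub: "h ` S \<subseteq> h' ` S"
      and IH: "\<And>j. j < i \<Longrightarrow> j \<in> S \<Longrightarrow> h j = h' j" for h h' :: "nat \<Rightarrow> 'b"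
  proof
    assume lt: "h i < h' i"
    obtain j where j: "j \<in> S" "h i = h' j" using sub less.prems by blast
    with lt have "j < i"
      using mono(2) less.prems by (metis linorder_neqE_nat order_less_asym strict_mono_onD)
    with IH j mono(1) less.prems show False
      by (metis order_less_irrefl strict_mono_onD)
  qed
  show ?case
    using key[of f g] key[of g f] f g im less.IH by (metis linorder_neqE order_refl)
qed

lemma adjacent_transposition_induct [consumes 1, case_names id comp]:
  fixes n :: nat
  assumes "w permutes {1..n}"
    and "P id"
    and "\<And>w i. \<lbrakk>w permutes {1..n}; i \<in> {1..<n}; P w\<rbrakk> \<Longrightarrow> P (w \<circ> transpose i (i + 1))"
  shows "P w"
  using assms(1)
proof (induction "n * n * n - weight n w" arbitrary: w rule: less_induct)
  case (less w)
  show ?case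
  proof (cases "\<exists>i\<in>{1..<n}. w (i + 1) < w i")
    case True
    then obtain i where i: "i \<in> {1..<n}" "w (i + 1) < w i" by blast
    define v where "v = w \<circ> transpose i (i + 1)"
    have v: "v permutes {1..n}"
      unfolding v_def using less.prems i by (intro permutes_comp_transpose) auto
    have "weight n w < weight n v"
      unfolding v_def using i by (intro weight_less_transpose) auto
    then have "P v"
      using less.hyps[OF _ v] weight_le[OF v] by linarith
    then have "P (v \<circ> transpose i (i + 1))"
      using assms(3) v i by blast
    then show ?thesis by (simp add: v_def comp_assoc)
  next
    case False
    have step: "w i < w (Suc i)" if "i \<in> {1..<n}" for i
    proof -
      have "w i \<noteq> w (Suc i)" using permutes_inj[OF less.prems] by (simp add: inj_eq)
      moreover have "\<not> w (Suc i) < w i" using that False by (metis Suc_eq_plus1)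
      ultimately show ?thesis by linarith
    qed
    have "w i < w j" if "i < j" "1 \<le> i" "j \<le> n" for i j
      using that
    proof (induction j)
      case (Suc j)
      then show ?case using step[of j] by (cases "i = j") auto
    qed simp
    then have "strict_mono_on {1..n} w" by (auto intro!: strict_mono_onI)
    moreover have "strict_mono_on {1..n} (id :: nat \<Rightarrow> nat)" by (auto intro!: strict_mono_onI)
    ultimately have "w i = id i" if "i \<in> {1..n}" for i
      using that permutes_image[OF less.prems] by (intro strict_mono_on_eqI[of "{1..n}" w id]) auto
    then have "w = id" using less.prems by (auto simp: permutes_def fun_eq_iff)
    then show ?thesis using assms(2) by simp
  qed
qed

definition avoids_321 :: "nat \<Rightarrow> (nat \<Rightarrow> nat) \<Rightarrow> bool" where
  "avoids_321 n w \<longleftrightarrow>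
    \<not> (\<exists>i j k. 1 \<le> i \<and> i < j \<and> j < k \<and> k \<le> n \<and> w k < w j \<and> w j < w i)"

lemma exc_val_eq: "exc_val n w = w ` exc_pos n w"
  by (auto simp: exc_val_def exc_pos_def)

lemma exc_class_iff:
  "w \<in> exc_class n P \<longleftrightarrow> w permutes {1..n} \<and> exc_val n w = {1..n} - fst ` P \<and>
    exc_pos n w = {1..n} - snd ` P"
  by (simp add: exc_class_def sym_group_carrier)

lemma noncrossing_partition_bounds:
  assumes "noncrossing_partition n P" "(i, j) \<in> P"
  shows "1 \<le> i" "i < j" "j \<le> n"
  using assms by (auto simp: noncrossing_partition_def)

lemma noncrossing_partition_nested:
  assumes "noncrossing_partition n P" "(i, k) \<in> P" "(j, l) \<in> P" "i \<le> j" "j < k" "k \<le> l"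
  shows "i = j \<and> k = l"
  using assms unfolding noncrossing_partition_def by blast

lemma noncrossing_partition_right_unique:
  assumes "noncrossing_partition n P" "(i, k) \<in> P" "(i, l) \<in> P"
  shows "k = l"
  using noncrossing_partition_nested[OF assms(1-3)] noncrossing_partition_nested[OF assms(1,3,2)]
    noncrossing_partition_bounds(2)[OF assms(1,2)] noncrossing_partition_bounds(2)[OF assms(1,3)]
  by linarith

lemma noncrossing_partition_left_unique:
  assumes "noncrossing_partition n P" "(i, k) \<in> P" "(j, k) \<in> P"
  shows "i = j"
  using noncrossing_partition_nested[OF assms(1-3)] noncrossing_partition_nested[OF assms(1,3,2)]
    noncrossing_partition_bounds(2)[OF assms(1,2)] noncrossing_partition_bounds(2)[OF assms(1,3)]
  by linarith

lemma noncrossing_partition_endpoints: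
  assumes "noncrossing_partition n P"
  shows "inj_on fst P" "inj_on snd P" "fst ` P \<subseteq> {1..n}" "snd ` P \<subseteq> {1..n}"
proof -
  show "inj_on fst P" "inj_on snd P"
    using noncrossing_partition_right_unique[OF assms] noncrossing_partition_left_unique[OF assms]
    by (auto intro!: inj_onI)
  show "fst ` P \<subseteq> {1..n}" "snd ` P \<subseteq> {1..n}"
    using noncrossing_partition_bounds[OF assms] by fastforce+
qed

lemma finite_noncrossing_partitions: "finite {P. noncrossing_partition n P}"
proof (rule finite_subset)
  show "{P. noncrossing_partition n P} \<subseteq> Pow ({1..n} \<times> {1..n})"
    using noncrossing_partition_bounds by fastforce
qed simp

lemma noncrossing_partition_eqI:
  assumes "noncrossing_partition n P" "noncrossing_partition n Q"
    and "fst ` P = fst ` Q" "snd ` P = snd ` Q"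
  shows "P = Q"
proof -
  have sub: "(i, k) \<in> Q"
    if "noncrossing_partition n P" "noncrossing_partition n Q" "fst ` P = fst ` Q" "snd ` P = snd ` Q"
      "(i, k) \<in> P" for P Q i k
    using that
  proof (induction "k - i" arbitrary: P Q i k rule: less_induct)
    case less
    note P = less.prems(1) and Q = less.prems(2) and ik = less.prems(5)
    have "i \<in> fst ` Q" "k \<in> snd ` Q"
      using ik less.prems(3,4)[symmetric] by (force simp: image_iff)+
    then obtain i' k' where k': "(i, k') \<in> Q" and i': "(i', k) \<in> Q" by auto
    have "i < k" "i < k'" "i' < k"
      using noncrossing_partition_bounds P Q ik k' i' by blast+
    show ?case
    proof (rule ccontr)
      assume notin: "(i, k) \<notin> Q"
      have "\<not> k' < k"
      proof
        assume "k' < k"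
        then have "(i, k') \<in> P"
          using less.hyps[OF _ Q P _ _ k'] less.prems(3,4) \<open>i < k'\<close> by simp
        with ik have "k' = k" using noncrossing_partition_right_unique[OF P] by blast
        with notin k' show False by simp
      qed
      moreover have "\<not> i < i'"
      proof
        assume "i < i'"
        then have "(i', k) \<in> P"
          using less.hyps[OF _ Q P _ _ i'] less.prems(3,4) \<open>i' < k\<close> by simp
        with ik have "i' = i" using noncrossing_partition_left_unique[OF P] by blast
        with notin i' show False by simp
      qed
      ultimately show False
        using noncrossing_partition_nested[OF Q i' k'] \<open>i < k\<close> notin k' by auto
    qed
  qed
  show ?thesis
    using sub[OF assms] sub[OF assms(2,1) assms(3)[symmetric] assms(4)[symmetric]] by (intro equalityI subrelI)
qed

lemma exc_class_exists:
  assumes "w permutes {1..n}"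
  shows "\<exists>P. noncrossing_partition n P \<and> w \<in> exc_class n P"
  using assms
proof (induction "weight n w" arbitrary: w rule: less_induct)
  case (less w)
  define P where "P = {(w d, d) | d. d \<in> {1..n} \<and> w d < d}"
  have inj: "w a = w b \<longleftrightarrow> a = b" for a b using permutes_inj[OF less.prems] by (simp add: inj_eq)
  have range: "w d \<in> {1..n}" if "d \<in> {1..n}" for d
    using permutes_in_image[OF less.prems, of d] that by simp
  show ?case
  proof (cases "noncrossing_partition n P")
    case True
    have pos: "exc_pos n w = {1..n} - snd ` P"
      by (force simp: exc_pos_def P_def image_iff)
    have "exc_pos n w = {1..n} - {d \<in> {1..n}. w d < d}" by (auto simp: exc_pos_def)
    then have "exc_val n w = w ` {1..n} - w ` {d \<in> {1..n}. w d < d}"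
      unfolding exc_val_eq by (simp add: image_set_diff permutes_inj[OF less.prems])
    moreover have "w ` {d \<in> {1..n}. w d < d} = fst ` P"
      by (force simp: P_def image_iff)
    ultimately have "exc_val n w = {1..n} - fst ` P" by (simp only: permutes_image[OF less.prems])
    with True pos less.prems show ?thesis by (auto simp: exc_class_iff)
  next
    case False
    moreover have "\<forall>(i, j)\<in>P. 1 \<le> i \<and> i < j \<and> j \<le> n"
      using range by (auto simp: P_def)
    ultimately obtain i j k l where "(i, k) \<in> P" "(j, l) \<in> P" "(i, k) \<noteq> (j, l)" "i \<le> j" "j < k" "k \<le> l"
      unfolding noncrossing_partition_def by blast
    then have kl: "k \<in> {1..n}" "l \<in> {1..n}" "k < l" "w k < w l" "w l < k"
      by (auto simp: P_def le_less inj)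
    define v where "v = w \<circ> transpose k l"
    have v: "v permutes {1..n}" unfolding v_def using less.prems kl by (intro permutes_comp_transpose)
    have wv: "w = v \<circ> transpose k l" by (simp add: v_def comp_assoc)
    have vkl: "v k = w l" "v l = w k" "\<And>d. d \<noteq> k \<Longrightarrow> d \<noteq> l \<Longrightarrow> v d = w d"
      by (simp_all add: v_def transpose_def)
    have "weight n v < weight n w"
      by (subst wv, rule weight_less_transpose) (use kl vkl in auto)
    then obtain Q where Q: "noncrossing_partition n Q" "v \<in> exc_class n Q"
      using less.hyps v by blast
    have "d \<le> v d \<longleftrightarrow> d \<le> w d" for d
      using kl vkl by (cases "d = k"; cases "d = l") auto
    then have pos: "exc_pos n v = exc_pos n w" by (simp add: exc_pos_def)
    have "v d = w d" if "d \<in> exc_pos n w" for d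
      using that kl vkl(3)[of d] by (force simp: exc_pos_def)
    then have "exc_val n v = exc_val n w" by (simp add: exc_val_eq pos)
    with pos Q less.prems show ?thesis by (auto simp: exc_class_iff)
  qed
qed

lemma avoids_321_mono_on_exc_pos:
  assumes w: "w permutes {1..n}" and av: "avoids_321 n w"
  shows "strict_mono_on (exc_pos n w) w"
proof (rule strict_mono_onI)
  fix i j assume ij: "i \<in> exc_pos n w" "j \<in> exc_pos n w" "i < j"
  show "w i < w j"
  proof (rule ccontr)
    assume "\<not> w i < w j"
    moreover have "w i \<noteq> w j" using permutes_inj[OF w] ij(3) by (simp add: inj_eq)
    ultimately have gt: "w j < w i" by simp
    have "{1..<w j} \<subseteq> w ` ({1..<j} - {i})"
    proof
      fix y assume y: "y \<in> {1..<w j}"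
      have "w j \<le> n" using permutes_in_image[OF w, of j] ij by (auto simp: exc_pos_def)
      then have "y \<in> w ` {1..n}" using y permutes_image[OF w] by auto
      then obtain k where k: "k \<in> {1..n}" "y = w k" by blast
      have "\<not> j < k"
        using av ij gt k y unfolding avoids_321_def exc_pos_def by auto
      moreover have "k \<noteq> j" "k \<noteq> i" using k y gt by auto
      ultimately show "y \<in> w ` ({1..<j} - {i})" using k by auto
    qed
    then have "card {1..<w j} \<le> card ({1..<j} - {i})"
      by (meson card_image_le card_mono finite_Diff finite_atLeastLessThan finite_imageI order_trans)
    moreover have "card ({1..<j} - {i}) = j - 2"
      using ij by (subst card_Diff_singleton) (auto simp: exc_pos_def)
    ultimately show False using ij by (auto simp: exc_pos_def)
  qed
qed

lemma avoids_321_mono_off_exc_pos: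
  assumes w: "w permutes {1..n}" and av: "avoids_321 n w"
  shows "strict_mono_on ({1..n} - exc_pos n w) w"
proof (rule strict_mono_onI)
  fix i j assume ij: "i \<in> {1..n} - exc_pos n w" "j \<in> {1..n} - exc_pos n w" "i < j"
  show "w i < w j"
  proof (rule ccontr)
    assume "\<not> w i < w j"
    moreover have "w i \<noteq> w j" using permutes_inj[OF w] ij(3) by (simp add: inj_eq)
    ultimately have gt: "w j < w i" by simp
    have "{w i<..n} \<subseteq> w ` ({i<..n} - {j})"
    proof
      fix y assume y: "y \<in> {w i<..n}"
      then have "y \<in> w ` {1..n}" using permutes_image[OF w] by auto
      then obtain k where k: "k \<in> {1..n}" "y = w k" by blast
      have "\<not> k < i"
        using av ij gt k y unfolding avoids_321_def by auto
      moreover have "k \<noteq> j" "k \<noteq> i" using k y gt by auto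
      ultimately show "y \<in> w ` ({i<..n} - {j})" using k by auto
    qed
    then have "card {w i<..n} \<le> card ({i<..n} - {j})"
      by (meson card_image_le card_mono finite_Diff finite_greaterThanAtMost finite_imageI order_trans)
    moreover have "card ({i<..n} - {j}) = n - i - 1"
      using ij by (subst card_Diff_singleton) auto
    ultimately show False using ij by (auto simp: exc_pos_def)
  qed
qed

lemma avoids_321_exc_class_unique:
  assumes "v \<in> exc_class n P" "avoids_321 n v" "w \<in> exc_class n P" "avoids_321 n w"
  shows "v = w"
proof -
  let ?E = "exc_pos n w"
  have v: "v permutes {1..n}" and w: "w permutes {1..n}"
    and pos: "exc_pos n v = ?E" and val: "v ` ?E = w ` ?E"
    using assms(1,3) unfolding exc_class_iff exc_val_eq by metis+
  have "v i = w i" if "i \<in> ?E" for i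
    using avoids_321_mono_on_exc_pos[OF v assms(2)] avoids_321_mono_on_exc_pos[OF w assms(4)]
      val that unfolding pos by (rule strict_mono_on_eqI)
  moreover have "v i = w i" if "i \<in> {1..n} - ?E" for i
  proof (rule strict_mono_on_eqI[OF _ _ _ that])
    show "strict_mono_on ({1..n} - ?E) v"
      using avoids_321_mono_off_exc_pos[OF v assms(2)] pos by simp
    show "strict_mono_on ({1..n} - ?E) w"
      using avoids_321_mono_off_exc_pos[OF w assms(4)] .
    show "v ` ({1..n} - ?E) = w ` ({1..n} - ?E)"
      by (simp only: image_set_diff[OF permutes_inj[OF v]] image_set_diff[OF permutes_inj[OF w]]
          permutes_image[OF v] permutes_image[OF w] val)
  qed
  ultimately show ?thesis
    using permutes_not_in[OF v] permutes_not_in[OF w] by (metis DiffI ext)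
qed

lemma card_avoids_321_le:
  "card {w. w permutes {1..n} \<and> avoids_321 n w} \<le> card {P. noncrossing_partition n P}"
proof -
  obtain c where c: "\<And>w. w permutes {1..n} \<Longrightarrow> noncrossing_partition n (c w) \<and> w \<in> exc_class n (c w)"
    using exc_class_exists[of _ n] by meson
  then have "inj_on c {w. w permutes {1..n} \<and> avoids_321 n w}"
    by (intro inj_onI) (metis (mono_tags, lifting) avoids_321_exc_class_unique mem_Collect_eq)
  then show ?thesis
    using c finite_noncrossing_partitions by (intro card_inj_on_le[of c]) auto
qed

definition arc_weight :: "(nat \<times> nat) set \<Rightarrow> int" where
  "arc_weight P = (\<Sum>(i, j)\<in>P. 2 * int j - 2 * int i - 1)"

lemma arc_weight_eq:
  assumes "noncrossing_partition n P" "w permutes {1..n}" "w ` snd ` P = fst ` P"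
  shows "arc_weight P = (\<Sum>j\<in>snd ` P. 2 * int j - 2 * int (w j) - 1)"
proof -
  note inj = noncrossing_partition_endpoints[OF assms(1)]
  have "inj_on w (snd ` P)" using permutes_inj[OF assms(2)] by (simp add: inj_on_def)
  then have *: "(\<Sum>i\<in>fst ` P. int i) = (\<Sum>j\<in>snd ` P. int (w j))"
    unfolding assms(3)[symmetric] by (subst sum.reindex) auto
  have "arc_weight P = (\<Sum>p\<in>P. 2 * int (snd p) - 1) - 2 * (\<Sum>p\<in>P. int (fst p))"
    unfolding arc_weight_def
    by (simp only: case_prod_unfold sum_distrib_left sum_subtractf[symmetric] algebra_simps)
  also have "\<dots> = (\<Sum>j\<in>snd ` P. 2 * int j - 1) - 2 * (\<Sum>i\<in>fst ` P. int i)"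
    using inj(1,2) by (simp add: sum.reindex)
  also have "\<dots> = (\<Sum>j\<in>snd ` P. 2 * int j - 2 * int (w j) - 1)"
    unfolding * by (simp only: sum_distrib_left sum_subtractf[symmetric] algebra_simps)
  finally show ?thesis .
qed

lemma exc_class_image:
  assumes Q: "noncrossing_partition n Q" and w: "w \<in> exc_class n Q"
  shows "w ` snd ` Q = fst ` Q"
proof -
  have perm: "w permutes {1..n}" using w by (simp add: exc_class_iff)
  note Qends = noncrossing_partition_endpoints(3,4)[OF Q]
  have "w ` exc_pos n w = {1..n} - fst ` Q" "exc_pos n w = {1..n} - snd ` Q"
    using w by (auto simp: exc_class_iff exc_val_eq)
  then have "w ` {1..n} - w ` snd ` Q = {1..n} - fst ` Q"
    by (simp add: image_set_diff permutes_inj[OF perm])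
  then show ?thesis
    using Qends image_mono[OF Qends(2), of w] unfolding permutes_image[OF perm] by blast
qed

lemma arc_weight_triangular:
  assumes P: "noncrossing_partition n P" and Q: "noncrossing_partition n Q"
    and w: "w \<in> exc_class n Q" and im: "w ` snd ` P = fst ` P"
    and le: "arc_weight Q \<le> arc_weight P"
  shows "P = Q"
proof -
  have perm: "w permutes {1..n}" using w by (simp add: exc_class_iff)
  note Qends = noncrossing_partition_endpoints(3,4)[OF Q]
  note Pends = noncrossing_partition_endpoints(3,4)[OF P]
  note imQ = exc_class_image[OF Q w]
  define g where "g j = 2 * int j - 2 * int (w j) - 1" for j
  have fin: "finite (snd ` P)" "finite (snd ` Q)"
    using Pends Qends by (auto intro: finite_subset[OF _ finite_atLeastAtMost])
  have sndQ: "j \<in> snd ` Q \<longleftrightarrow> w j < j" if "j \<in> {1..n}" for j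
  proof -
    have "j \<in> snd ` Q \<longleftrightarrow> j \<notin> exc_pos n w" using w that by (simp add: exc_class_iff)
    then show ?thesis using that by (simp add: exc_pos_def not_le)
  qed
  have pos: "g j > 0" if "j \<in> snd ` Q" for j
    using sndQ[of j] that Qends by (auto simp: g_def)
  have neg: "g j < 0" if "j \<in> snd ` P - snd ` Q" for j
    using sndQ[of j] that Pends by (auto simp: g_def)
  have "sum g (snd ` P) = sum g (snd ` P \<inter> snd ` Q) + sum g (snd ` P - snd ` Q)"
    using fin by (metis sum.Int_Diff)
  moreover have "sum g (snd ` Q) = sum g (snd ` P \<inter> snd ` Q) + sum g (snd ` Q - snd ` P)"
    using fin by (metis sum.Int_Diff Int_commute)
  moreover have "arc_weight P = sum g (snd ` P)" "arc_weight Q = sum g (snd ` Q)"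
    unfolding g_def by (intro arc_weight_eq[OF P perm im] arc_weight_eq[OF Q perm imQ])+
  ultimately have le': "sum g (snd ` Q - snd ` P) \<le> sum g (snd ` P - snd ` Q)"
    using le by linarith
  have nonneg: "sum g (snd ` Q - snd ` P) \<ge> 0"
    using pos by (intro sum_nonneg) (auto intro: less_imp_le)
  have "snd ` P - snd ` Q = {}"
  proof (rule ccontr)
    assume "snd ` P - snd ` Q \<noteq> {}"
    then have "0 < (\<Sum>j\<in>snd ` P - snd ` Q. - g j)"
      using neg fin by (intro sum_pos) simp_all
    then have "sum g (snd ` P - snd ` Q) < 0"
      by (simp add: sum_negf)
    with le' nonneg show False by simp
  qed
  moreover have "snd ` Q - snd ` P = {}"
  proof (rule ccontr)
    assume "snd ` Q - snd ` P \<noteq> {}"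
    then have "0 < sum g (snd ` Q - snd ` P)"
      using pos fin by (intro sum_pos) simp_all
    moreover have "sum g (snd ` P - snd ` Q) = 0"
      unfolding \<open>snd ` P - snd ` Q = {}\<close> by simp
    ultimately show False using le' by simp
  qed
  ultimately have snds: "snd ` P = snd ` Q" by blast
  with im imQ have "fst ` P = fst ` Q" by simp
  with P Q snds show ?thesis by (intro noncrossing_partition_eqI)
qed

section \<open>The action of the Temperley-Lieb algebra on functions of subsets\<close>

lemma word_monoid_monoid: "monoid (word_monoid X)"
  by (rule monoidI) (auto simp: word_monoid_def)

lemma free_algebra_complex_algebra: "complex_algebra (free_algebra X)"
  by (rule monoid_algebra_complex_algebra[OF word_monoid_monoid])

lemma carrier_free_algebra: "carrier (free_algebra X) = {f. Poly_Mapping.keys f \<subseteq> lists X}"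
  by (simp add: monoid_algebra_simps word_monoid_def)

lemma single_in_free_algebra: "u \<in> lists X \<Longrightarrow> Poly_Mapping.single u c \<in> carrier (free_algebra X)"
  by (auto simp: carrier_free_algebra)

lemma mult_single_free_algebra:
  "Poly_Mapping.single u c \<otimes>\<^bsub>free_algebra X\<^esub> Poly_Mapping.single v d = Poly_Mapping.single (u @ v) (c * d)"
  by (simp add: mult_single_single word_monoid_def)

fun word_act :: "nat list \<Rightarrow> (nat set \<Rightarrow> complex) \<Rightarrow> nat set \<Rightarrow> complex" where
  "word_act [] v = v"
| "word_act (i # u) v = word_act u (\<lambda>S. v S - v (transpose i (i + 1) ` S))"

definition alg_act :: "(nat list \<Rightarrow>\<^sub>0 complex) \<Rightarrow> (nat set \<Rightarrow> complex) \<Rightarrow> nat set \<Rightarrow> complex" where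
  "alg_act f v S = (\<Sum>u\<in>Poly_Mapping.keys f. Poly_Mapping.lookup f u * word_act u v S)"

lemma word_act_append: "word_act (u @ u') v = word_act u' (word_act u v)"
  by (induction u arbitrary: v) auto

lemma word_act_add: "word_act u (\<lambda>S. v S + v' S) = (\<lambda>S. word_act u v S + word_act u v' S)"
proof (induction u arbitrary: v v')
  case (Cons i u)
  have "word_act (i # u) (\<lambda>S. v S + v' S) = word_act u (\<lambda>S. (v S - v (transpose i (i + 1) ` S))
    + (v' S - v' (transpose i (i + 1) ` S)))"
    by (simp add: algebra_simps)
  then show ?case by (simp only: Cons.IH word_act.simps)
qed simp

lemma word_act_smult: "word_act u (\<lambda>S. c * v S) = (\<lambda>S. c * word_act u v S)"
proof (induction u arbitrary: v)
  case (Cons i u)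
  have "word_act (i # u) (\<lambda>S. c * v S) = word_act u (\<lambda>S. c * (v S - v (transpose i (i + 1) ` S)))"
    by (simp add: algebra_simps)
  then show ?case by (simp only: Cons.IH word_act.simps)
qed simp

lemma alg_act_superset:
  assumes "finite U" "Poly_Mapping.keys f \<subseteq> U"
  shows "alg_act f v S = (\<Sum>u\<in>U. Poly_Mapping.lookup f u * word_act u v S)"
  unfolding alg_act_def using assms by (intro sum.mono_neutral_left) (auto simp: in_keys_iff)

lemma alg_act_zero [simp]: "alg_act 0 v S = 0"
  by (simp add: alg_act_def)

lemma alg_act_add: "alg_act (f + g) v S = alg_act f v S + alg_act g v S"
proof -
  let ?U = "Poly_Mapping.keys f \<union> Poly_Mapping.keys g"
  have "Poly_Mapping.keys (f + g) \<subseteq> ?U" by (rule Poly_Mapping.keys_add)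
  then show ?thesis
    by (simp add: alg_act_superset[of ?U] lookup_add distrib_right sum.distrib)
qed

lemma alg_act_single [simp]: "alg_act (Poly_Mapping.single u c) v S = c * word_act u v S"
  by (simp add: alg_act_superset[of "{u}"])

lemma alg_act_diff: "alg_act (f - g) v S = alg_act f v S - alg_act g v S"
  using alg_act_add[of "f - g" g v S] by simp

lemma alg_act_smult: "alg_act (c \<odot>\<^bsub>free_algebra X\<^esub> f) v S = c * alg_act f v S"
  by (subst alg_act_superset[OF finite_keys keys_smult])
    (simp add: alg_act_def lookup_smult sum_distrib_left mult.assoc)

lemma alg_act_vector_add: "alg_act f (\<lambda>S. v S + v' S) S = alg_act f v S + alg_act f v' S"
  by (simp add: alg_act_def word_act_add distrib_left sum.distrib)

lemma alg_act_vector_smult: "alg_act f (\<lambda>S. c * v S) S = c * alg_act f v S"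
  by (simp add: alg_act_def word_act_smult sum_distrib_left mult.left_commute)

lemma alg_act_vector_zero: "alg_act f (\<lambda>S. 0) S = 0"
  using alg_act_vector_smult[of f 0 "\<lambda>S. 0" S] by simp

lemma alg_act_mult: "alg_act (f \<otimes>\<^bsub>free_algebra X\<^esub> g) v S = alg_act g (alg_act f v) S"
proof -
  have "Poly_Mapping.keys f \<subseteq> UNIV" "Poly_Mapping.keys g \<subseteq> UNIV" by auto
  then show ?thesis
  proof (induction f rule: finite_support_induct)
    case zero
    have "alg_act 0 v = (\<lambda>S. 0)" by (simp add: fun_eq_iff)
    then show ?case by (simp add: alg_act_vector_zero)
  next
    case (add f f')
    have "alg_act (f + f') v = (\<lambda>S. alg_act f v S + alg_act f' v S)" by (simp add: fun_eq_iff alg_act_add)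
    then show ?case using add by (simp add: mult_add_left alg_act_add alg_act_vector_add)
  next
    case (single a c)
    have a: "alg_act (Poly_Mapping.single a c) v = (\<lambda>S. c * word_act a v S)" by (simp add: fun_eq_iff)
    from single(2) show ?case
    proof (induction g rule: finite_support_induct)
      case (single b d)
      show ?case
        by (simp add: a mult_single_free_algebra word_act_append word_act_smult)
    qed (simp_all add: mult_add_right alg_act_add)
  qed
qed

text \<open>On functions of subsets the relation \<open>e\<^sub>i e\<^sub>j e\<^sub>i = e\<^sub>i\<close> says that the antisymmetrizer of three
  points vanishes; this holds because two of the points are both inside or both outside a given set.\<close>

lemma antisymmetrizer_vanishes:
  fixes v :: "nat set \<Rightarrow> complex"
  assumes ab: "s = transpose a b" "t = transpose b c" and "distinct [a, b, c]"
  shows "v S + v (s ` t ` S) + v (t ` s ` S) = v (s ` S) + v (t ` S) + v (s ` t ` s ` S)"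
proof -
  have invol: "s ` s ` X = X" "t ` t ` X = X" for X
    by (simp_all add: ab image_image)
  have braid: "t ` s ` t ` X = s ` t ` s ` X" for X
    unfolding image_image ab using assms(3) by (intro image_cong) (auto simp: transpose_def)
  have fix_transpose: "transpose x y ` S = S" if "x \<in> S \<longleftrightarrow> y \<in> S" for x y
    using that by (auto simp: transpose_def image_iff split: if_splits)
  have sts: "s ` t ` s ` X = transpose a c ` X" for X
    unfolding image_image ab using assms(3) by (intro image_cong) (auto simp: transpose_def)
  consider "a \<in> S \<longleftrightarrow> b \<in> S" | "b \<in> S \<longleftrightarrow> c \<in> S" | "a \<in> S \<longleftrightarrow> c \<in> S" by blast
  then show ?thesis
  proof cases
    case 1
    then have "s ` S = S" using fix_transpose ab by simp
    then show ?thesis by simp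
  next
    case 2
    then have t: "t ` S = S" using fix_transpose ab by simp
    moreover have "s ` t ` s ` S = t ` s ` S"
      using braid[of S] t by simp
    ultimately show ?thesis by simp
  next
    case 3
    then have S: "s ` t ` s ` S = S" using fix_transpose sts by simp
    then have "t ` s ` S = s ` S" using invol by metis
    moreover have "s ` t ` S = t ` S" using S braid[of S] invol by metis
    ultimately show ?thesis using S by simp
  qed
qed

lemma TL_relators_act:
  assumes "f \<in> TL_relators n"
  shows "alg_act f v S = 0"
proof -
  have invol: "transpose a b ` transpose a b ` T = T" for a b :: nat and T
    by (simp add: image_image)
  have braid_rel: "alg_act (Poly_Mapping.single [i, j, i] 1 - Poly_Mapping.single [i] 1) v S = 0"
    if "\<bar>int i - int j\<bar> = 1" for i j
  proof -
    let ?s = "transpose i (i + 1)" and ?t = "transpose j (j + 1)"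
    have "v S + v (?s ` ?t ` S) + v (?t ` ?s ` S) = v (?s ` S) + v (?t ` S) + v (?s ` ?t ` ?s ` S)"
    proof (cases "j = i + 1")
      case True
      then show ?thesis by (intro antisymmetrizer_vanishes[of _ i "i + 1" _ "i + 2"]) auto
    next
      case False
      with that have "i = j + 1" by linarith
      then show ?thesis
        by (intro antisymmetrizer_vanishes[of _ "i + 1" i _ j]) (auto simp: transpose_commute)
    qed
    then show ?thesis by (simp add: alg_act_diff invol algebra_simps)
  qed
  have comm_rel: "alg_act (Poly_Mapping.single [i, j] 1 - Poly_Mapping.single [j, i] 1) v S = 0"
    if "\<bar>int i - int j\<bar> > 1" for i j
  proof -
    have "transpose i (i + 1) ` transpose j (j + 1) ` S = transpose j (j + 1) ` transpose i (i + 1) ` S"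
      unfolding image_image using that by (intro image_cong) (auto simp: transpose_def)
    then show ?thesis by (simp add: alg_act_diff)
  qed
  have "alg_act (Poly_Mapping.single [i, i] 1 - Poly_Mapping.single [i] 2) v S = 0" for i
    by (simp add: alg_act_diff invol algebra_simps)
  with assms braid_rel comm_rel show ?thesis unfolding TL_relators_def by blast
qed

lemma TL_relators_carrier: "TL_relators n \<subseteq> carrier (free_algebra {1..<n})"
proof -
  have diff: "f - g \<in> carrier (free_algebra X)"
    if "f \<in> carrier (free_algebra X)" "g \<in> carrier (free_algebra X)" for f g and X :: "nat set"
  proof -
    have "Poly_Mapping.keys (f - g) \<subseteq> Poly_Mapping.keys f \<union> Poly_Mapping.keys g"
      by (auto simp: in_keys_iff lookup_minus)
    with that show ?thesis unfolding carrier_free_algebra by blast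
  qed
  show ?thesis
    unfolding TL_relators_def by (auto intro!: diff single_in_free_algebra)
qed

lemma TL_ideal_ideal: "ideal (TL_ideal n) (free_algebra {1..<n})"
proof -
  interpret complex_algebra "free_algebra {1..<n}" by (rule free_algebra_complex_algebra)
  show ?thesis unfolding TL_ideal_def by (rule genideal_ideal[OF TL_relators_carrier])
qed

lemma TL_relators_subset: "TL_relators n \<subseteq> TL_ideal n"
proof -
  interpret complex_algebra "free_algebra {1..<n}" by (rule free_algebra_complex_algebra)
  show ?thesis unfolding TL_ideal_def by (rule genideal_self[OF TL_relators_carrier])
qed

lemma TL_ideal_act:
  assumes "f \<in> TL_ideal n"
  shows "alg_act f v S = 0"
proof -
  let ?F = "free_algebra {1..<n}"
  interpret F: complex_algebra ?F by (rule free_algebra_complex_algebra)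
  define J where "J = {f \<in> carrier ?F. \<forall>v. alg_act f v = (\<lambda>S. 0)}"
  have "ideal J ?F"
  proof (rule idealI[OF F.ring_axioms])
    show "subgroup J (add_monoid ?F)"
    proof (rule F.add.subgroupI)
      show "J \<subseteq> carrier ?F" by (auto simp: J_def)
      have "0 \<in> J" using F.zero_closed by (simp add: J_def monoid_algebra_simps fun_eq_iff)
      then show "J \<noteq> {}" by auto
      show "\<ominus>\<^bsub>?F\<^esub> f \<in> J" if "f \<in> J" for f
      proof -
        have "f \<in> carrier ?F" using that by (simp add: J_def)
        then have "\<ominus>\<^bsub>?F\<^esub> f = (-1) \<odot>\<^bsub>?F\<^esub> f"
          by (rule F.smult_minus_one[symmetric])
        moreover have "(-1) \<odot>\<^bsub>?F\<^esub> f \<in> carrier ?F"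
          using \<open>f \<in> carrier ?F\<close> by (rule F.smult_closed)
        ultimately show ?thesis using that by (simp add: J_def alg_act_smult fun_eq_iff)
              qed
      show "f \<oplus>\<^bsub>?F\<^esub> g \<in> J" if "f \<in> J" "g \<in> J" for f g
      proof -
        have "f \<oplus>\<^bsub>?F\<^esub> g \<in> carrier ?F" using that by (simp add: J_def del: One_nat_def)
        with that show ?thesis by (simp add: J_def monoid_algebra_simps(4) alg_act_add fun_eq_iff)
      qed
    qed
    show "g \<otimes>\<^bsub>?F\<^esub> f \<in> J" "f \<otimes>\<^bsub>?F\<^esub> g \<in> J" if "f \<in> J" "g \<in> carrier ?F" for f g
    proof -
      have f: "f \<in> carrier ?F" and z: "alg_act f v = (\<lambda>S. 0)" for v
        using that by (simp_all add: J_def)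
      have "alg_act (g \<otimes>\<^bsub>?F\<^esub> f) v = (\<lambda>S. 0)" "alg_act (f \<otimes>\<^bsub>?F\<^esub> g) v = (\<lambda>S. 0)" for v
        by (rule ext, simp only: alg_act_mult z alg_act_vector_zero)+
      then show "g \<otimes>\<^bsub>?F\<^esub> f \<in> J" "f \<otimes>\<^bsub>?F\<^esub> g \<in> J"
        using F.m_closed[OF f that(2)] F.m_closed[OF that(2) f] unfolding J_def by blast+
    qed
  qed
  moreover have "TL_relators n \<subseteq> J"
    using TL_relators_carrier TL_relators_act by (auto simp: J_def fun_eq_iff)
  ultimately have "TL_ideal n \<subseteq> J"
    unfolding TL_ideal_def by (rule F.genideal_minimal)
  with assms show ?thesis by (auto simp: J_def fun_eq_iff)
qed

lemma TL_complex_algebra: "complex_algebra (TL n)"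
  unfolding TL_def
  by (rule quot_algebra_complex_algebra[OF free_algebra_complex_algebra TL_ideal_ideal])

definition TL_class :: "nat \<Rightarrow> (nat list \<Rightarrow>\<^sub>0 complex) \<Rightarrow> (nat list \<Rightarrow>\<^sub>0 complex) set" where
  "TL_class n f = TL_ideal n +>\<^bsub>free_algebra {1..<n}\<^esub> f"

definition TL_act :: "(nat list \<Rightarrow>\<^sub>0 complex) set \<Rightarrow> (nat set \<Rightarrow> complex) \<Rightarrow> nat set \<Rightarrow> complex" where
  "TL_act X = alg_act (SOME f. f \<in> X)"

lemma TL_carrierE:
  assumes "X \<in> carrier (TL n)"
  obtains f where "f \<in> carrier (free_algebra {1..<n})" "X = TL_class n f"
  using assms unfolding TL_def TL_class_def by (rule quot_algebra_carrierE)

lemma TL_class_hom: "TL_class n \<in> alg_hom (free_algebra {1..<n}) (TL n)"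
  unfolding TL_def TL_class_def[abs_def]
  by (rule coset_alg_hom[OF free_algebra_complex_algebra TL_ideal_ideal])

lemmas TL_class_ring_hom = TL_class_hom[unfolded alg_hom_def, THEN CollectD, THEN conjunct1]

lemma TL_class_smult:
  "f \<in> carrier (free_algebra {1..<n}) \<Longrightarrow>
    TL_class n (c \<odot>\<^bsub>free_algebra {1..<n}\<^esub> f) = c \<odot>\<^bsub>TL n\<^esub> TL_class n f"
  using TL_class_hom by (simp add: alg_hom_def)

lemma TL_act_class:
  assumes "f \<in> carrier (free_algebra {1..<n})"
  shows "TL_act (TL_class n f) = alg_act f"
proof -
  interpret ideal "TL_ideal n" "free_algebra {1..<n}" by (rule TL_ideal_ideal)
  have "f \<in> TL_class n f" unfolding TL_class_def using assms by (rule a_rcos_self)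
  then have "(SOME g. g \<in> TL_class n f) \<in> TL_class n f" by (rule someI)
  then obtain h where "h \<in> TL_ideal n" "(SOME g. g \<in> TL_class n f) = h + f"
    by (auto simp: TL_class_def a_r_coset_def' monoid_algebra_simps)
  then show ?thesis
    by (simp add: TL_act_def alg_act_add TL_ideal_act fun_eq_iff)
qed

lemma TL_act_add:
  assumes "X \<in> carrier (TL n)" "Y \<in> carrier (TL n)"
  shows "TL_act (X \<oplus>\<^bsub>TL n\<^esub> Y) v S = TL_act X v S + TL_act Y v S"
proof -
  interpret complex_algebra "free_algebra {1..<n}" by (rule free_algebra_complex_algebra)
  obtain f g where fg: "f \<in> carrier (free_algebra {1..<n})" "X = TL_class n f"
    "g \<in> carrier (free_algebra {1..<n})" "Y = TL_class n g"
    using assms by (elim TL_carrierE)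
  have "TL_act (X \<oplus>\<^bsub>TL n\<^esub> Y) = alg_act (f \<oplus>\<^bsub>free_algebra {1..<n}\<^esub> g)"
    using fg by (simp add: ring_hom_add[OF TL_class_ring_hom, symmetric] TL_act_class del: One_nat_def)
  then show ?thesis using fg by (simp add: TL_act_class monoid_algebra_simps(4) alg_act_add)
qed

lemma TL_act_mult:
  assumes "X \<in> carrier (TL n)" "Y \<in> carrier (TL n)"
  shows "TL_act (X \<otimes>\<^bsub>TL n\<^esub> Y) v S = TL_act Y (TL_act X v) S"
proof -
  interpret complex_algebra "free_algebra {1..<n}" by (rule free_algebra_complex_algebra)
  obtain f g where fg: "f \<in> carrier (free_algebra {1..<n})" "X = TL_class n f"
    "g \<in> carrier (free_algebra {1..<n})" "Y = TL_class n g"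
    using assms by (elim TL_carrierE)
  have "TL_act (X \<otimes>\<^bsub>TL n\<^esub> Y) = alg_act (f \<otimes>\<^bsub>free_algebra {1..<n}\<^esub> g)"
    using fg by (simp add: ring_hom_mult[OF TL_class_ring_hom, symmetric] TL_act_class del: One_nat_def)
  then show ?thesis using fg by (simp add: TL_act_class alg_act_mult)
qed

lemma TL_act_smult:
  assumes "X \<in> carrier (TL n)"
  shows "TL_act (c \<odot>\<^bsub>TL n\<^esub> X) v S = c * TL_act X v S"
proof -
  interpret complex_algebra "free_algebra {1..<n}" by (rule free_algebra_complex_algebra)
  obtain f where f: "f \<in> carrier (free_algebra {1..<n})" "X = TL_class n f"
    using assms by (elim TL_carrierE)
  then show ?thesis
    by (simp add: TL_class_smult[symmetric] TL_act_class alg_act_smult del: One_nat_def)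
qed

lemma TL_act_one: "TL_act \<one>\<^bsub>TL n\<^esub> v S = v S"
proof -
  have "\<one>\<^bsub>TL n\<^esub> = TL_class n (Poly_Mapping.single [] 1)"
    using ring_hom_one[OF TL_class_ring_hom] by (simp add: monoid_algebra_simps word_monoid_def)
  then show ?thesis by (simp add: TL_act_class single_in_free_algebra)
qed

lemma TL_act_minus:
  assumes "X \<in> carrier (TL n)" "Y \<in> carrier (TL n)"
  shows "TL_act (X \<ominus>\<^bsub>TL n\<^esub> Y) v S = TL_act X v S - TL_act Y v S"
proof -
  interpret complex_algebra "TL n" by (rule TL_complex_algebra)
  have "X \<ominus>\<^bsub>TL n\<^esub> Y = X \<oplus>\<^bsub>TL n\<^esub> (-1) \<odot>\<^bsub>TL n\<^esub> Y"
    using assms by (simp only: minus_eq smult_minus_one)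
  then show ?thesis using assms by (simp add: TL_act_add TL_act_smult)
qed

lemma TL_act_zero: "TL_act \<zero>\<^bsub>TL n\<^esub> v S = 0"
proof -
  interpret complex_algebra "TL n" by (rule TL_complex_algebra)
  show ?thesis using TL_act_add[of "\<zero>\<^bsub>TL n\<^esub>" n "\<zero>\<^bsub>TL n\<^esub>" v S] by simp
qed

lemma TL_nontrivial: "\<one>\<^bsub>TL n\<^esub> \<noteq> \<zero>\<^bsub>TL n\<^esub>"
  using TL_act_one[of n "\<lambda>S. 1" "{}"] TL_act_zero[of n "\<lambda>S. 1" "{}"] by auto

lemma TL_gen_eq: "TL_gen n i = TL_class n (Poly_Mapping.single [i] 1)"
  by (simp add: TL_gen_def TL_class_def)

lemma TL_gen_closed: "i \<in> {1..<n} \<Longrightarrow> TL_gen n i \<in> carrier (TL n)"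
  unfolding TL_gen_eq by (intro ring_hom_closed[OF TL_class_ring_hom] single_in_free_algebra) auto

lemma TL_gen_act:
  "i \<in> {1..<n} \<Longrightarrow> TL_act (TL_gen n i) v S = v S - v (transpose i (i + 1) ` S)"
  unfolding TL_gen_eq by (subst TL_act_class) (auto intro!: single_in_free_algebra)

lemma TL_class_Cons:
  assumes "i \<in> {1..<n}" "u \<in> lists {1..<n}"
  shows "TL_class n (Poly_Mapping.single (i # u) 1) = TL_gen n i \<otimes>\<^bsub>TL n\<^esub> TL_class n (Poly_Mapping.single u 1)"
  unfolding TL_gen_eq using assms
  by (subst ring_hom_mult[OF TL_class_ring_hom, symmetric])
    (auto intro!: single_in_free_algebra simp: mult_single_free_algebra)

lemma TL_class_eqI:
  assumes "f - g \<in> TL_ideal n" "g \<in> carrier (free_algebra {1..<n})"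
  shows "TL_class n f = TL_class n g"
proof -
  interpret ideal "TL_ideal n" "free_algebra {1..<n}" by (rule TL_ideal_ideal)
  have "f = (f - g) \<oplus>\<^bsub>free_algebra {1..<n}\<^esub> g" by (simp add: monoid_algebra_simps)
  with assms(1) have "f \<in> TL_class n g"
    unfolding TL_class_def a_r_coset_def' by blast
  then show ?thesis
    unfolding TL_class_def using assms(2) by (intro a_repr_independence'[symmetric])
qed

lemma TL_gen_square:
  assumes "i \<in> {1..<n}"
  shows "TL_gen n i \<otimes>\<^bsub>TL n\<^esub> TL_gen n i = TL_gen n i \<oplus>\<^bsub>TL n\<^esub> TL_gen n i"
proof -
  have "TL_gen n i \<otimes>\<^bsub>TL n\<^esub> TL_gen n i = TL_class n (Poly_Mapping.single [i, i] 1)"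
    using assms TL_class_Cons[of i n "[i]"] by (simp add: TL_gen_eq)
  also have "\<dots> = TL_class n (Poly_Mapping.single [i] 2)"
    using assms TL_relators_subset[of n]
    by (intro TL_class_eqI single_in_free_algebra) (auto simp: TL_relators_def)
  also have "Poly_Mapping.single [i] (2::complex) =
      Poly_Mapping.single [i] 1 \<oplus>\<^bsub>free_algebra {1..<n}\<^esub> Poly_Mapping.single [i] 1"
    by (simp add: monoid_algebra_simps single_add[symmetric])
  also have "TL_class n \<dots> = TL_gen n i \<oplus>\<^bsub>TL n\<^esub> TL_gen n i"
    unfolding TL_gen_eq using assms
    by (intro ring_hom_add[OF TL_class_ring_hom] single_in_free_algebra) auto
  finally show ?thesis .
qed

lemma TL_gen_braid:
  assumes "i \<in> {1..<n}" "j \<in> {1..<n}" "\<bar>int i - int j\<bar> = 1"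
  shows "TL_gen n i \<otimes>\<^bsub>TL n\<^esub> (TL_gen n j \<otimes>\<^bsub>TL n\<^esub> TL_gen n i) = TL_gen n i"
proof -
  have "TL_gen n i \<otimes>\<^bsub>TL n\<^esub> (TL_gen n j \<otimes>\<^bsub>TL n\<^esub> TL_gen n i) = TL_class n (Poly_Mapping.single [i, j, i] 1)"
    using assms TL_class_Cons[of j n "[i]"] TL_class_Cons[of i n "[j, i]"] by (simp add: TL_gen_eq)
  also have "\<dots> = TL_gen n i"
    unfolding TL_gen_eq
  proof (rule TL_class_eqI)
    have "Poly_Mapping.single [i, j, i] 1 - Poly_Mapping.single [i] 1 \<in> TL_relators n"
      unfolding TL_relators_def using assms by blast
    then show "Poly_Mapping.single [i, j, i] 1 - Poly_Mapping.single [i] 1 \<in> TL_ideal n"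
      using TL_relators_subset by blast
  qed (use assms(1) in \<open>auto intro!: single_in_free_algebra\<close>)
  finally show ?thesis .
qed

lemma (in ring) antisymmetrizer_expand:
  assumes ef: "e \<in> carrier R" "f \<in> carrier R"
    and sq: "e \<otimes> e = e \<oplus> e" and braid: "e \<otimes> (f \<otimes> e) = e"
    and s: "s = \<one> \<ominus> e" and t: "t = \<one> \<ominus> f"
  shows "\<one> \<oplus> (s \<otimes> t \<oplus> t \<otimes> s) = s \<oplus> t \<oplus> s \<otimes> t \<otimes> s"
proof -
  note simps = minus_eq l_distr r_distr l_minus r_minus minus_add m_assoc a_ac
  have "s \<otimes> t \<otimes> s =
      \<one> \<ominus> e \<ominus> e \<oplus> e \<otimes> e \<ominus> f \<oplus> e \<otimes> f \<oplus> f \<otimes> e \<ominus> e \<otimes> (f \<otimes> e)"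
    unfolding s t using ef by (simp add: simps)
  also have "\<dots> = \<one> \<ominus> f \<oplus> e \<otimes> f \<oplus> f \<otimes> e \<ominus> e"
    unfolding sq braid using ef by algebra
  moreover have "s \<otimes> t = \<one> \<ominus> e \<ominus> f \<oplus> e \<otimes> f" "t \<otimes> s = \<one> \<ominus> e \<ominus> f \<oplus> f \<otimes> e"
    unfolding s t using ef by (simp_all add: simps)
  ultimately show ?thesis
    unfolding s t using ef by algebra
qed

section \<open>Straightening and the basis\<close>

lemma exists_permutation_three_points:
  fixes i j k n :: nat
  assumes "i \<in> {1..n}" "j \<in> {1..n}" "k \<in> {1..n}" "distinct [i, j, k]" "3 \<le> n"
  obtains u where "u permutes {1..n}" "u 1 = i" "u 2 = j" "u 3 = k"
proof -
  define u1 where "u1 = transpose 1 i"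
  define u2 where "u2 = transpose 2 (u1 j)"
  define u3 where "u3 = transpose 3 (u2 (u1 k))"
  have u1: "u1 permutes {1..n}"
    unfolding u1_def using assms by (intro permutes_swap_id) auto
  then have "u1 j \<in> {1..n}" "u1 k \<in> {1..n}"
    using assms by (simp_all only: permutes_in_image)
  then have u2: "u2 permutes {1..n}"
    unfolding u2_def using assms by (intro permutes_swap_id) auto
  then have "u2 (u1 k) \<in> {1..n}"
    using \<open>u1 k \<in> {1..n}\<close> by (simp only: permutes_in_image)
  then have u3: "u3 permutes {1..n}"
    unfolding u3_def using assms by (intro permutes_swap_id) auto
  have invol: "u1 (u1 x) = x" "u2 (u2 x) = x" for x
    by (simp_all add: u1_def u2_def)
  have "u1 i = 1" "u2 (u1 j) = 2" by (simp_all add: u1_def u2_def)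
  have ne: "u1 j \<noteq> 1" "u1 k \<noteq> 1" "u1 k \<noteq> u1 j"
    using assms(4) invol(1) \<open>u1 i = 1\<close> by (metis distinct_length_2_or_more)+
  then have "u2 1 = 1" by (simp add: u2_def transpose_def)
  have ne2: "u2 (u1 k) \<noteq> 1" "u2 (u1 k) \<noteq> 2"
    using ne invol(2) \<open>u2 1 = 1\<close> \<open>u2 (u1 j) = 2\<close> by metis+
  show ?thesis
  proof (rule that[of "u1 \<circ> u2 \<circ> u3"])
    show "u1 \<circ> u2 \<circ> u3 permutes {1..n}" using u1 u2 u3 by (intro permutes_compose)
    have "u3 1 = 1" using ne2 by (simp add: u3_def transpose_def)
    then show "(u1 \<circ> u2 \<circ> u3) 1 = i" using \<open>u2 1 = 1\<close> by (simp add: u1_def)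
    have "u3 2 = 2" using ne2 by (simp add: u3_def transpose_def)
    then show "(u1 \<circ> u2 \<circ> u3) 2 = j" using invol by (simp add: u2_def)
    show "(u1 \<circ> u2 \<circ> u3) 3 = k" using invol by (simp add: u3_def)
  qed
qed

locale antisymmetrizer_killing_rep = ring R for R (structure) +
  fixes n :: nat and p :: "(nat \<Rightarrow> nat) \<Rightarrow> 'a"
  assumes p_closed: "w permutes {1..n} \<Longrightarrow> p w \<in> carrier R"
    and p_comp: "\<lbrakk>v permutes {1..n}; w permutes {1..n}\<rbrakk> \<Longrightarrow> p (v \<circ> w) = p v \<otimes> p w"
    and p_id: "p id = \<one>"
    and antisymmetrizer: "3 \<le> n \<Longrightarrow>
      \<one> \<oplus> (p (transpose 1 2 \<circ> transpose 2 3) \<oplus> p (transpose 2 3 \<circ> transpose 1 2)) =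
      p (transpose 1 2) \<oplus> p (transpose 2 3) \<oplus> p (transpose 1 3)"
begin

lemma antisymmetrizer_at:
  assumes w: "w permutes {1..n}"
    and ijk: "i \<in> {1..n}" "j \<in> {1..n}" "k \<in> {1..n}" "distinct [i, j, k]"
  shows "p w \<oplus> (p (w \<circ> transpose i j \<circ> transpose j k) \<oplus> p (w \<circ> transpose j k \<circ> transpose i j)) =
    p (w \<circ> transpose i j) \<oplus> p (w \<circ> transpose j k) \<oplus> p (w \<circ> transpose i k)"
proof -
  have "card {i, j, k} \<le> card {1..n}" using ijk by (intro card_mono) auto
  then have n: "3 \<le> n" using ijk(4) by simp
  obtain u where u: "u permutes {1..n}" "u 1 = i" "u 2 = j" "u 3 = k"
    using exists_permutation_three_points[OF ijk n] .
  define u' where "u' = Hilbert_Choice.inv u"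
  have u': "u' permutes {1..n}" unfolding u'_def using u(1) by (rule permutes_inv)
  have uu': "u \<circ> u' = id" "u' \<circ> u = id" unfolding u'_def using u(1) by (simp_all add: permutes_inv_o)
  have conj: "u \<circ> transpose a b \<circ> u' = transpose (u a) (u b)" for a b
  proof -
    have "transpose (u a) (u b) \<circ> u = u \<circ> transpose a b"
      using permutes_inj[OF u(1)] by (auto simp: fun_eq_iff transpose_def inj_eq)
    then have "u \<circ> transpose a b \<circ> u' = transpose (u a) (u b) \<circ> (u \<circ> u')" by (metis comp_assoc)
    then show ?thesis using uu' by simp
  qed
  have perm: "transpose a b permutes {1..n}" if "a \<in> {1,2,3}" "b \<in> {1,2,3}" for a b :: nat
    using that n by (intro permutes_swap_id) auto
  let ?s = "transpose 1 2 :: nat \<Rightarrow> nat" and ?t = "transpose 2 3 :: nat \<Rightarrow> nat"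
    and ?r = "transpose 1 3 :: nat \<Rightarrow> nat"
  have st: "?s permutes {1..n}" "?t permutes {1..n}" "?r permutes {1..n}" using perm by simp_all
  have conj_p: "p (w \<circ> u) \<otimes> p x \<otimes> p u' = p (w \<circ> y)" if "x permutes {1..n}" "u \<circ> x \<circ> u' = y" for x y
    using that w u(1) u' by (simp add: p_comp[symmetric] permutes_compose comp_assoc)
  have wu: "w \<circ> u permutes {1..n}" using w u(1) by (intro permutes_compose)
  note closed = p_closed[OF wu] p_closed[OF u'] p_closed[OF st(1)] p_closed[OF st(2)] p_closed[OF st(3)]
    p_closed[OF permutes_compose[OF st(1,2)]] p_closed[OF permutes_compose[OF st(2,1)]]
  have conj2: "u \<circ> (x \<circ> y) \<circ> u' = (u \<circ> x \<circ> u') \<circ> (u \<circ> y \<circ> u')" for x y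
    using uu'(2) by (metis comp_assoc comp_id)
  have "p (w \<circ> u) \<otimes> p id \<otimes> p u' \<oplus> (p (w \<circ> u) \<otimes> p (?s \<circ> ?t) \<otimes> p u' \<oplus> p (w \<circ> u) \<otimes> p (?t \<circ> ?s) \<otimes> p u')
      = p (w \<circ> u) \<otimes> (\<one> \<oplus> (p (?s \<circ> ?t) \<oplus> p (?t \<circ> ?s))) \<otimes> p u'"
    using closed by (simp add: l_distr r_distr p_id)
  also have "\<dots> = p (w \<circ> u) \<otimes> (p ?s \<oplus> p ?t \<oplus> p ?r) \<otimes> p u'"
    by (simp only: antisymmetrizer[OF n])
  also have "\<dots> = p (w \<circ> u) \<otimes> p ?s \<otimes> p u' \<oplus> p (w \<circ> u) \<otimes> p ?t \<otimes> p u' \<oplus> p (w \<circ> u) \<otimes> p ?r \<otimes> p u'"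
    using closed by (simp add: l_distr r_distr)
  finally show ?thesis
    using uu'(1) by (simp only: comp_assoc[of w] comp_id u(2-4)
        conj_p[OF permutes_id refl] conj_p[OF st(1) conj] conj_p[OF st(2) conj] conj_p[OF st(3) conj]
        conj_p[OF permutes_compose[OF st(1,2)] conj2] conj_p[OF permutes_compose[OF st(2,1)] conj2] conj)
qed

text \<open>Sorting a decreasing triple of values increases the weight, so the relation above expresses
  a permutation containing the pattern 321 through permutations of larger weight.\<close>

lemma spanned_by_avoids_321:
  assumes add: "\<And>x y. \<lbrakk>x \<in> T; y \<in> T\<rbrakk> \<Longrightarrow> x \<oplus> y \<in> T" and minus: "\<And>x. x \<in> T \<Longrightarrow> \<ominus> x \<in> T"
    and base: "\<And>w. \<lbrakk>w permutes {1..n}; avoids_321 n w\<rbrakk> \<Longrightarrow> p w \<in> T"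
    and w: "w permutes {1..n}"
  shows "p w \<in> T"
  using w
proof (induction "n * n * n - weight n w" arbitrary: w rule: less_induct)
  case (less w)
  show ?case
  proof (cases "avoids_321 n w")
    case True
    with less.prems base show ?thesis by blast
  next
    case False
    then obtain i j k where ijk: "1 \<le> i" "i < j" "j < k" "k \<le> n" "w k < w j" "w j < w i"
      unfolding avoids_321_def by blast
    then have mem: "i \<in> {1..n}" "j \<in> {1..n}" "k \<in> {1..n}" by auto
    let ?a = "w \<circ> transpose i j" and ?b = "w \<circ> transpose j k" and ?c = "w \<circ> transpose i k"
    note perm = permutes_comp_transpose[OF less.prems mem(1,2)]
      permutes_comp_transpose[OF less.prems mem(2,3)] permutes_comp_transpose[OF less.prems mem(1,3)]
    note perm = perm permutes_comp_transpose[OF perm(1) mem(2,3)]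
      permutes_comp_transpose[OF perm(2) mem(1,2)]
    have larger: "p v \<in> T" if "v permutes {1..n}" "weight n w < weight n v" for v
      using that less.hyps[of v] weight_le[of v n] by linarith
    have lt: "weight n w < weight n ?a" "weight n w < weight n ?b" "weight n w < weight n ?c"
      using ijk mem by (intro weight_less_transpose; simp)+
    moreover have "weight n ?a < weight n (?a \<circ> transpose j k)"
      "weight n ?b < weight n (?b \<circ> transpose i j)"
      using ijk mem by (intro weight_less_transpose; simp add: transpose_def)+
    ultimately have in_T: "p ?a \<in> T" "p ?b \<in> T" "p ?c \<in> T"
      "p (?a \<circ> transpose j k) \<in> T" "p (?b \<circ> transpose i j) \<in> T"
      using perm by (auto intro!: larger simp del: o_apply)
    have "p w = p ?a \<oplus> p ?b \<oplus> p ?c \<oplus> \<ominus> (p (?a \<circ> transpose j k) \<oplus> p (?b \<circ> transpose i j))"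
    proof -
      have eq: "p w \<oplus> (p (?a \<circ> transpose j k) \<oplus> p (?b \<circ> transpose i j)) = p ?a \<oplus> p ?b \<oplus> p ?c"
        using ijk mem less.prems by (intro antisymmetrizer_at) auto
      have cancel: "x = z \<oplus> \<ominus> y" if "x \<oplus> y = z" "x \<in> carrier R" "y \<in> carrier R" for x y z
        using that by (auto simp: a_assoc r_neg)
      show ?thesis
        by (rule cancel[OF eq p_closed[OF less.prems] a_closed[OF p_closed[OF perm(4)] p_closed[OF perm(5)]]])
    qed
    then show ?thesis using in_T by (auto intro!: add minus)
  qed
qed

end

locale TL_quotient_map =
  fixes n :: nat and \<phi> :: "((nat \<Rightarrow> nat) \<Rightarrow>\<^sub>0 complex) \<Rightarrow> (nat list \<Rightarrow>\<^sub>0 complex) set"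
  assumes phi_hom: "\<phi> \<in> alg_hom (sym_algebra n) (TL n)"
    and phi_simple: "i \<in> {1..<n} \<Longrightarrow>
      \<phi> (perm_elt (transpose i (i + 1))) = \<one>\<^bsub>TL n\<^esub> \<ominus>\<^bsub>TL n\<^esub> TL_gen n i"
begin

abbreviation img :: "(nat \<Rightarrow> nat) \<Rightarrow> (nat list \<Rightarrow>\<^sub>0 complex) set" where
  "img w \<equiv> \<phi> (perm_elt w)"

lemma phi_ring_hom: "\<phi> \<in> ring_hom (sym_algebra n) (TL n)"
  using phi_hom by (simp add: alg_hom_def)

lemma perm_elt_closed: "w permutes {1..n} \<Longrightarrow> perm_elt w \<in> carrier (sym_algebra n)"
  by (simp add: monoid_algebra_simps sym_group_carrier)

lemma img_closed: "w permutes {1..n} \<Longrightarrow> img w \<in> carrier (TL n)"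
  by (intro ring_hom_closed[OF phi_ring_hom] perm_elt_closed)

lemma img_comp:
  "\<lbrakk>v permutes {1..n}; w permutes {1..n}\<rbrakk> \<Longrightarrow> img (v \<circ> w) = img v \<otimes>\<^bsub>TL n\<^esub> img w"
  by (subst ring_hom_mult[OF phi_ring_hom, symmetric])
    (auto intro: perm_elt_closed simp: mult_single_single sym_group_mult)

lemma img_id: "img id = \<one>\<^bsub>TL n\<^esub>"
  using ring_hom_one[OF phi_ring_hom] by (simp add: monoid_algebra_simps sym_group_one)

lemma img_antisymmetrizer:
  assumes "3 \<le> n"
  shows "\<one>\<^bsub>TL n\<^esub> \<oplus>\<^bsub>TL n\<^esub>
      (img (transpose 1 2 \<circ> transpose 2 3) \<oplus>\<^bsub>TL n\<^esub> img (transpose 2 3 \<circ> transpose 1 2)) =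
    img (transpose 1 2) \<oplus>\<^bsub>TL n\<^esub> img (transpose 2 3) \<oplus>\<^bsub>TL n\<^esub> img (transpose 1 3)"
proof -
  interpret TL: complex_algebra "TL n" by (rule TL_complex_algebra)
  have perm: "transpose 1 2 permutes {1..n}" "transpose 2 3 permutes {1..n}"
    using assms by (auto intro!: permutes_swap_id)
  have r: "transpose 1 3 = transpose 1 2 \<circ> transpose 2 3 \<circ> (transpose 1 2 :: nat \<Rightarrow> nat)"
    by (auto simp: fun_eq_iff transpose_def)
  have s: "img (transpose 1 2) = \<one>\<^bsub>TL n\<^esub> \<ominus>\<^bsub>TL n\<^esub> TL_gen n 1"
    using phi_simple[of 1] assms by (simp add: numeral_2_eq_2)
  have t: "img (transpose 2 3) = \<one>\<^bsub>TL n\<^esub> \<ominus>\<^bsub>TL n\<^esub> TL_gen n 2"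
    using phi_simple[of 2] assms by simp
  have "1 \<in> {1..<n}" "2 \<in> {1..<n}" using assms by auto
  then show ?thesis
    unfolding r img_comp[OF permutes_compose[OF perm(2,1)] perm(1)] img_comp[OF perm] img_comp[OF perm(2,1)]
    by (intro TL.antisymmetrizer_expand[OF _ _ _ _ s t] TL_gen_closed TL_gen_square TL_gen_braid) auto
qed

lemma antisymmetrizer_killing_rep: "antisymmetrizer_killing_rep (TL n) n img"
proof -
  interpret TL: complex_algebra "TL n" by (rule TL_complex_algebra)
  show ?thesis
    by (intro antisymmetrizer_killing_rep.intro antisymmetrizer_killing_rep_axioms.intro
        TL.ring_axioms img_closed img_comp img_id img_antisymmetrizer)
qed

lemma img_act:
  assumes "w permutes {1..n}"
  shows "TL_act (img w) v S = v (w ` S)"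
  using assms
proof (induction arbitrary: v S rule: adjacent_transposition_induct)
  case id
  show ?case by (simp add: img_id[unfolded id_def] TL_act_one)
next
  case (comp w i)
  interpret TL: complex_algebra "TL n" by (rule TL_complex_algebra)
  have i: "transpose i (i + 1) permutes {1..n}" using comp(2) by (intro permutes_swap_id) auto
  have s: "TL_act (img (transpose i (i + 1))) v S = v (transpose i (i + 1) ` S)" for v S
    using comp(2) by (simp add: phi_simple[simplified] TL_act_minus TL_act_one TL_gen_act TL_gen_closed)
  have "img (w \<circ> transpose i (i + 1)) = img w \<otimes>\<^bsub>TL n\<^esub> img (transpose i (i + 1))"
    using comp(1) i by (rule img_comp)
  then show ?case
    using comp(1) i by (simp only: TL_act_mult[OF img_closed img_closed] s comp.IH image_comp)
qed

lemma carrier_subset_of_closed: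
  assumes zero: "\<zero>\<^bsub>TL n\<^esub> \<in> T" and add: "\<And>x y. \<lbrakk>x \<in> T; y \<in> T\<rbrakk> \<Longrightarrow> x \<oplus>\<^bsub>TL n\<^esub> y \<in> T"
    and smult: "\<And>c x. x \<in> T \<Longrightarrow> c \<odot>\<^bsub>TL n\<^esub> x \<in> T"
    and sub: "T \<subseteq> carrier (TL n)"
    and base: "\<And>w. \<lbrakk>w permutes {1..n}; avoids_321 n w\<rbrakk> \<Longrightarrow> img w \<in> T"
  shows "carrier (TL n) \<subseteq> T"
proof
  interpret TL: complex_algebra "TL n" by (rule TL_complex_algebra)
  interpret F: complex_algebra "free_algebra {1..<n}" by (rule free_algebra_complex_algebra)
  interpret rep: antisymmetrizer_killing_rep "TL n" n img by (rule antisymmetrizer_killing_rep)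
  have minus: "\<ominus>\<^bsub>TL n\<^esub> x \<in> T" if "x \<in> T" for x
    using smult[OF that, of "-1"] that sub TL.smult_minus_one by (metis subsetD)
  have img: "img w \<in> T" if "w permutes {1..n}" for w
    using add minus base that by (rule rep.spanned_by_avoids_321)
  have word: "img w \<otimes>\<^bsub>TL n\<^esub> TL_class n (Poly_Mapping.single u 1) \<in> T"
    if "u \<in> lists {1..<n}" "w permutes {1..n}" for u w
    using that
  proof (induction u arbitrary: w rule: lists.induct)
    case Nil
    have "TL_class n (Poly_Mapping.single [] 1) = \<one>\<^bsub>TL n\<^esub>"
      using ring_hom_one[OF TL_class_ring_hom] by (simp add: monoid_algebra_simps word_monoid_def)
    then show ?case using img Nil by (simp add: img_closed)
  next
    case (Cons i u)
    let ?t = "transpose i (i + 1)" and ?q = "TL_class n (Poly_Mapping.single u 1)"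
    have t: "?t permutes {1..n}" using Cons by (intro permutes_swap_id) auto
    have wt: "w \<circ> ?t permutes {1..n}" using t Cons.prems by (intro permutes_compose)
    have q: "?q \<in> carrier (TL n)"
      using Cons(2) by (intro ring_hom_closed[OF TL_class_ring_hom] single_in_free_algebra)
    note closed = TL_gen_closed[OF Cons(1)] img_closed[OF Cons.prems] img_closed[OF wt] q img_closed[OF t]
    have "TL_gen n i = \<one>\<^bsub>TL n\<^esub> \<oplus>\<^bsub>TL n\<^esub> \<ominus>\<^bsub>TL n\<^esub> img ?t"
      unfolding phi_simple[OF Cons(1)] using closed by (simp add: TL.minus_eq TL.minus_add TL.r_neg2)
    then have "img w \<otimes>\<^bsub>TL n\<^esub> TL_gen n i = img w \<oplus>\<^bsub>TL n\<^esub> \<ominus>\<^bsub>TL n\<^esub> (img w \<otimes>\<^bsub>TL n\<^esub> img ?t)"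
      using closed by (simp only: TL.r_distr TL.r_minus TL.r_one TL.one_closed TL.a_inv_closed)
    also have "img w \<otimes>\<^bsub>TL n\<^esub> img ?t = img (w \<circ> ?t)"
      using img_comp[OF Cons.prems t] by simp
    finally have eq: "img w \<otimes>\<^bsub>TL n\<^esub> (TL_gen n i \<otimes>\<^bsub>TL n\<^esub> ?q) =
        img w \<otimes>\<^bsub>TL n\<^esub> ?q \<oplus>\<^bsub>TL n\<^esub> \<ominus>\<^bsub>TL n\<^esub> (img (w \<circ> ?t) \<otimes>\<^bsub>TL n\<^esub> ?q)"
      using closed by (simp add: TL.m_assoc[symmetric] TL.l_distr TL.l_minus)
    show ?case
      unfolding TL_class_Cons[OF Cons(1,2)] eq
      by (intro add minus Cons.IH[OF Cons.prems] Cons.IH[OF wt])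
  qed
  fix X assume "X \<in> carrier (TL n)"
  then obtain f where f: "f \<in> carrier (free_algebra {1..<n})" "X = TL_class n f"
    by (rule TL_carrierE)
  from f(1) have "Poly_Mapping.keys f \<subseteq> lists {1..<n}" by (simp add: carrier_free_algebra)
  then have "TL_class n f \<in> T"
  proof (induction rule: finite_support_induct)
    case zero
    have "TL_class n 0 = \<zero>\<^bsub>TL n\<^esub>"
      using ring_hom_zero[OF TL_class_ring_hom F.ring_axioms TL.ring_axioms]
      by (simp add: monoid_algebra_simps)
    then show ?case using assms(1) by simp
  next
    case (add f g)
    then have "TL_class n (f + g) = TL_class n f \<oplus>\<^bsub>TL n\<^esub> TL_class n g"
      by (subst ring_hom_add[OF TL_class_ring_hom, symmetric])
        (simp_all add: carrier_free_algebra monoid_algebra_simps(4))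
    with add assms(2) show ?case by simp
  next
    case (single u c)
    have s: "Poly_Mapping.single u 1 \<in> carrier (free_algebra {1..<n})"
      using single by (rule single_in_free_algebra)
    then have "img id \<otimes>\<^bsub>TL n\<^esub> TL_class n (Poly_Mapping.single u 1) = TL_class n (Poly_Mapping.single u 1)"
      by (simp add: img_id ring_hom_closed[OF TL_class_ring_hom] del: One_nat_def)
    then have "TL_class n (Poly_Mapping.single u 1) \<in> T"
      using word[OF single permutes_id] by simp
    then have "TL_class n (c \<odot>\<^bsub>free_algebra {1..<n}\<^esub> Poly_Mapping.single u 1) \<in> T"
      using s by (simp only: TL_class_smult smult)
    then show ?case by (simp add: smult_single)
  qed
  with f show "X \<in> T" by simp
qed

end

lemma (in complex_algebra) Span_scalars_subset:
  assumes "\<zero> \<in> Z" "\<And>x y. \<lbrakk>x \<in> Z; y \<in> Z\<rbrakk> \<Longrightarrow> x \<oplus> y \<in> Z" "\<And>c x. x \<in> Z \<Longrightarrow> c \<odot> x \<in> Z"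
    and "Z \<subseteq> carrier A" "set Us \<subseteq> Z"
  shows "Span (scalars A) Us \<subseteq> Z"
  using assms(5)
proof (induction Us)
  case (Cons u Us)
  then have u: "u \<in> Z" and sub: "Span (scalars A) Us \<subseteq> Z" by simp_all
  have mult: "k \<otimes> u \<in> Z" if k: "k \<in> scalars A" for k
  proof -
    obtain c where "k = c \<odot> \<one>" using k unfolding scalars_def by blast
    moreover have "u \<in> carrier A" using u assms(4) by blast
    ultimately show ?thesis using assms(3)[OF u] by (simp add: smult_mult_one)
  qed
  show ?case
    using sub by (auto simp: line_extension_mem_iff intro!: assms(2) mult)
qed (use assms(1) in simp)

lemma (in ring) exists_short_base:
  assumes "subfield K R" "set Us \<subseteq> carrier R"
  shows "\<exists>Vs. independent K Vs \<and> Span K Vs = Span K Us \<and> length Vs \<le> length Us"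
  using assms(2)
proof (induction Us)
  case (Cons u Us)
  then obtain Vs where Vs: "independent K Vs" "Span K Vs = Span K Us" "length Vs \<le> length Us"
    by auto
  show ?case
  proof (cases "u \<in> Span K Us")
    case True
    have "Span K (u # Us) \<subseteq> Span K Us"
      using True Cons.prems Span_base_incl[OF assms(1)]
      by (intro mono_Span_subset[OF assms(1)]) auto
    moreover have "Span K Us \<subseteq> Span K (u # Us)"
      using Cons.prems by (intro mono_Span[OF assms(1)]) auto
    ultimately show ?thesis using Vs by (intro exI[of _ Vs]) auto
  next
    case False
    then have "independent K (u # Vs)" using Vs Cons.prems by (intro li_Cons) auto
    moreover have "Span K (u # Vs) = Span K (u # Us)" using Vs(2) by simp
    ultimately show ?thesis using Vs(3) by (intro exI[of _ "u # Vs"]) auto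
  qed
qed auto

context TL_quotient_map
begin

lemma img_exc_class_independent:
  assumes "finite F" "\<And>P. P \<in> F \<Longrightarrow> noncrossing_partition n P"
    and "\<And>P. P \<in> F \<Longrightarrow> w P \<in> exc_class n P"
  shows "\<exists>Us. set Us = (\<lambda>P. img (w P)) ` F \<and> length Us = card F \<and>
    ring.independent (TL n) (scalars (TL n)) Us"
  using assms
proof (induction F rule: finite_ranking_induct[where f = arc_weight])
  case empty
  interpret TL: complex_algebra "TL n" by (rule TL_complex_algebra)
  show ?case by (intro exI[of _ "[]"]) auto
next
  case (insert P F)
  interpret TL: complex_algebra "TL n" by (rule TL_complex_algebra)
  let ?K = "scalars (TL n)"
  obtain Us where Us: "set Us = (\<lambda>P. img (w P)) ` F" "length Us = card F" "TL.independent ?K Us"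
    using insert by auto
  show ?case
  proof (cases "P \<in> F")
    case True
    with Us show ?thesis by (auto simp: insert_absorb)
  next
    case False
    have perm: "w Q permutes {1..n}" if "Q \<in> insert P F" for Q
      using insert(5)[OF that] by (simp add: exc_class_iff)
    define L where "L X = TL_act X (\<lambda>S. if S = fst ` P then 1 else 0) (snd ` P)" for X
    have L: "L (img (w Q)) = (if w Q ` snd ` P = fst ` P then 1 else 0)" if "Q \<in> insert P F" for Q
      unfolding L_def using img_act[OF perm[OF that]] by simp
    define Z where "Z = {X \<in> carrier (TL n). L X = 0}"
    have "set Us \<subseteq> Z"
    proof
      fix X assume "X \<in> set Us"
      then obtain Q where Q: "Q \<in> F" "X = img (w Q)" using Us by auto
      then have "w Q ` snd ` P \<noteq> fst ` P"
        using arc_weight_triangular[of n P Q "w Q"] insert(2)[of Q] insert(4,5) False by auto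
      with Q L perm show "X \<in> Z" by (auto simp: Z_def img_closed)
    qed
    then have "TL.Span ?K Us \<subseteq> Z"
      by (intro TL.Span_scalars_subset)
        (auto simp: Z_def L_def TL_act_add TL_act_smult TL_act_zero)
    moreover have "L (img (w P)) = 1"
      using L[of P] exc_class_image[of n P "w P"] insert(4,5)[of P] by simp
    ultimately have "img (w P) \<notin> TL.Span ?K Us" by (auto simp: Z_def)
    then have "TL.independent ?K (img (w P) # Us)"
      using Us(3) perm by (intro TL.li_Cons img_closed) auto
    then show ?thesis
      using Us insert(1) False by (intro exI[of _ "img (w P) # Us"]) auto
  qed
qed

lemma is_finite_basis_img:
  assumes "\<And>P. noncrossing_partition n P \<Longrightarrow> w P \<in> exc_class n P"
  shows "is_finite_basis (TL n) {img (w P) | P. noncrossing_partition n P}"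
proof -
  interpret TL: complex_algebra "TL n" by (rule TL_complex_algebra)
  let ?K = "scalars (TL n)" and ?N = "{P. noncrossing_partition n P}"
  have K: "subfield ?K (TL n)" by (rule TL.subfield_scalars[OF TL_nontrivial])
  obtain Us where Us: "set Us = (\<lambda>P. img (w P)) ` ?N" "length Us = card ?N" "TL.independent ?K Us"
    using img_exc_class_independent[OF finite_noncrossing_partitions[of n], where w = w] assms by auto
  have "finite {v. v permutes {1..n} \<and> avoids_321 n v}"
    by (rule finite_subset[OF _ finite_permutations[of "{1..n}"]]) auto
  then obtain vs where vs: "set vs = {v. v permutes {1..n} \<and> avoids_321 n v}" "distinct vs"
    using finite_distinct_list by blast
  let ?Vs = "map img vs"
  have Vs: "set ?Vs \<subseteq> carrier (TL n)" using vs by (auto intro: img_closed)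
  have "carrier (TL n) \<subseteq> TL.Span ?K ?Vs"
  proof (rule carrier_subset_of_closed)
    show "c \<odot>\<^bsub>TL n\<^esub> X \<in> TL.Span ?K ?Vs" if "X \<in> TL.Span ?K ?Vs" for c X
    proof -
      have "X \<in> carrier (TL n)" using that TL.Span_subgroup_props(1)[OF K Vs] by blast
      moreover have "(c \<odot>\<^bsub>TL n\<^esub> \<one>\<^bsub>TL n\<^esub>) \<otimes>\<^bsub>TL n\<^esub> X \<in> TL.Span ?K ?Vs"
        using that by (intro TL.Span_smult_closed[OF K Vs]) (auto simp: scalars_def)
      ultimately show ?thesis by (simp only: TL.smult_mult_one)
    qed
    show "img v \<in> TL.Span ?K ?Vs" if "v permutes {1..n}" "avoids_321 n v" for v
      using that vs TL.Span_base_incl[OF K Vs] by auto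
  qed (use TL.Span_subgroup_props[OF K Vs] in blast)+
  then obtain Ws where Ws: "TL.independent ?K Ws" "carrier (TL n) \<subseteq> TL.Span ?K Ws"
    "length Ws \<le> length ?Vs"
    using TL.exists_short_base[OF K Vs] by metis
  have "length ?Vs \<le> card ?N"
    using card_avoids_321_le[of n] vs by (metis distinct_card length_map)
  have "TL.Span ?K Us = carrier (TL n)"
  proof (rule ccontr)
    assume ne: "TL.Span ?K Us \<noteq> carrier (TL n)"
    have "TL.Span ?K Us \<subseteq> carrier (TL n)"
      by (rule TL.Span_subgroup_props(1)[OF K TL.independent_in_carrier[OF Us(3)]])
    with ne obtain X where X: "X \<in> carrier (TL n)" "X \<notin> TL.Span ?K Us" by blast
    then have ind: "TL.independent ?K (X # Us)" using Us(3) by (intro TL.li_Cons)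
    then have "length (X # Us) \<le> length Ws"
      using TL.independent_in_carrier[OF ind] Ws by (intro TL.independent_length_le[OF K]) auto
    with Ws(3) \<open>length ?Vs \<le> card ?N\<close> Us(2) show False by simp
  qed
  with Us show ?thesis unfolding is_finite_basis_def by (intro exI[of _ Us]) auto
qed

end

theorem theorem5p3:
  fixes n :: nat
    and \<phi> :: "((nat \<Rightarrow> nat) \<Rightarrow>\<^sub>0 complex) \<Rightarrow> (nat list \<Rightarrow>\<^sub>0 complex) set"
    and w :: "(nat \<times> nat) set \<Rightarrow> nat \<Rightarrow> nat"
  assumes phi_hom: "\<phi> \<in> alg_hom (sym_algebra n) (TL n)"
    and phi_simple: "\<And>i. i \<in> {1..<n} \<Longrightarrow>
      \<phi> (perm_elt (transpose i (i + 1))) = \<one>\<^bsub>TL n\<^esub> \<ominus>\<^bsub>TL n\<^esub> TL_gen n i"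
    and w_class: "\<And>P. noncrossing_partition n P \<Longrightarrow> w P \<in> exc_class n P"
  shows "is_finite_basis (TL n) {\<phi> (perm_elt (w P)) | P. noncrossing_partition n P}"
  by (intro TL_quotient_map.is_finite_basis_img TL_quotient_map.intro assms)

end
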